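(* Let $Z$ be a Banach space with a basis $(z_i)$. Let $1\le p<\infty$ and $K<\infty$. Assume that for all $n\in\mathbb{N}$ and all $(d_i)_{i=1}^n\in\{Z\}_n$, $$K^{-1}n^{1/p}\le\Big\|\sum_{i=1}^n d_i\Big\|\le K n^{1/p}.$$ Then every infinite dimensional subspace of $Z$ contains an asymptotic $\ell_p$ basic sequence.
   Context: Asymptotic structure: for a Banach space $Z$ with basis $(z_i)$ and $n\in\mathbb{N}$, $\{Z\}_n$ (the $n$-th asymptotic structure of $Z$ with respect to $(z_i)$) is the set of normalized basic sequences $(d_i)_{i=1}^n$ such that: for all $\varepsilon>0$, for all $m_1$ there exists $y_1\in\mathrm{span}(z_i)_{i\ge m_1}$, for all $m_2$ there exists $y_2\in\mathrm{span}(z_i)_{i\ge m_2}$, $\ldots$, for all $m_n$ there exists $y_n\in\mathrm{span}(z_i)_{i\ge m_n}$, so that $(y_i)_{i=1}^n$ is $(1+\varepsilon)$-equivalent to $(d_i)_{i=1}^n$. A basic sequence $(e_i)$ is called an asymptotic $\ell_p$ basic sequence (it is an asymptotic $\ell_p$ basis for its closed linear span) if there is $C<\infty$ such that for all $n$, every normalized block basis $(x_i)_{i=1}^n$ of $(e_i)_{i=n}^\infty$ is $C$-equivalent to the unit vector basis of $\ell_p^n$. Two sequences $(x_i)$ and $(y_i)$ are $C$-equivalent if there are $A,B>0$ with $AB\le C$ such that $A^{-1}\|\sum a_iy_i\|\le\|\sum a_ix_i\|\le B\|\sum a_iy_i\|$ for all (finitely supported) scalar sequences $(a_i)$. Subspaces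 are closed. *)

theory Defs
  imports "HOL-Analysis.Analysis"
begin

text \<open>
  Sequences are indexed from 0, so entry \<open>i\<close> stands for the entry with index \<open>i + 1\<close> in the
  usual 1-based notation. Scalars are real.
\<close>

definition schauder_basis_of :: "(nat \<Rightarrow> 'a::real_normed_vector) \<Rightarrow> 'a set \<Rightarrow> bool" where
  "schauder_basis_of z S \<longleftrightarrow>
     range z \<subseteq> S \<and> (\<forall>x\<in>S. \<exists>!a::nat \<Rightarrow> real. (\<lambda>i. a i *\<^sub>R z i) sums x)"

definition basic_sequence :: "(nat \<Rightarrow> 'a::real_normed_vector) \<Rightarrow> bool" where
  "basic_sequence e \<longleftrightarrow> schauder_basis_of e (closure (span (range e)))"

definition infinite_dimensional :: "'a::real_vector set \<Rightarrow> bool" where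
  "infinite_dimensional X \<longleftrightarrow> (\<nexists>B. finite B \<and> span B = X)"

text \<open>
  Finite sequences living in different normed spaces are compared through the norms they induce
  on coefficients: a sequence \<open>x\<close> of length \<open>n\<close> gives \<open>a \<mapsto> \<parallel>\<Sum>i<n. a i x i\<parallel>\<close>, a function of
  \<open>a :: nat \<Rightarrow> real\<close> depending only on the first \<open>n\<close> coordinates.
\<close>

definition coeff_norm ::
  "nat \<Rightarrow> (nat \<Rightarrow> 'a::real_normed_vector) \<Rightarrow> (nat \<Rightarrow> real) \<Rightarrow> real" where
  "coeff_norm n x a = norm (\<Sum>i<n. a i *\<^sub>R x i)"

text \<open>The coefficient norm of the unit vector basis of \<open>\<ell>\<^sub>p\<close> in dimension \<open>n\<close>.\<close>

definition lp_coeff_norm :: "real \<Rightarrow> nat \<Rightarrow> (nat \<Rightarrow> real) \<Rightarrow> real" where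
  "lp_coeff_norm p n a = (\<Sum>i<n. \<bar>a i\<bar> powr p) powr (1 / p)"

text \<open>\<open>C\<close>-equivalence of two finite sequences with coefficient norms \<open>N\<close> and \<open>M\<close>.\<close>

definition C_equivalent ::
  "real \<Rightarrow> ((nat \<Rightarrow> real) \<Rightarrow> real) \<Rightarrow> ((nat \<Rightarrow> real) \<Rightarrow> real) \<Rightarrow> bool" where
  "C_equivalent C N M \<longleftrightarrow>
     (\<exists>A B. A > 0 \<and> B > 0 \<and> A * B \<le> C \<and>
        (\<forall>a. inverse A * M a \<le> N a \<and> N a \<le> B * M a))"

text \<open>
  A normalized basic sequence \<open>d\<close> of length \<open>n\<close> in an unspecified normed space is represented by
  its coefficient norm, that is, by the space \<open>\<real>\<^sup>n\<close> with the norm that makes the unit vectors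
  an isometric copy of \<open>d\<close>; in particular \<open>\<parallel>\<Sum>i<n. d i\<parallel>\<close> is \<open>N (\<lambda>i. 1)\<close>. For a finite sequence, being basic means being linearly independent,
  which is the definiteness condition. A norm on \<open>\<real>\<^sup>n\<close> is encoded as a seminorm on
  \<open>nat \<Rightarrow> real\<close> whose kernel consists of the \<open>a\<close> vanishing on the first \<open>n\<close> coordinates.
\<close>

definition normalized_basic_norm :: "nat \<Rightarrow> ((nat \<Rightarrow> real) \<Rightarrow> real) \<Rightarrow> bool" where
  "normalized_basic_norm n N \<longleftrightarrow>
     (\<forall>a. 0 \<le> N a) \<and>
     (\<forall>a. N a = 0 \<longleftrightarrow> (\<forall>i<n. a i = 0)) \<and>
     (\<forall>c a. N (\<lambda>i. c * a i) = \<bar>c\<bar> * N a) \<and>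
     (\<forall>a b. N (\<lambda>i. a i + b i) \<le> N a + N b) \<and>
     (\<forall>j<n. N (\<lambda>i. if i = j then 1 else 0) = 1)"

lemma normalized_basic_norm_coeff_norm:
  fixes d :: "nat \<Rightarrow> 'a::real_normed_vector"
  assumes inj: "inj_on d {..<n}" and indep: "independent (d ` {..<n})"
    and nrm: "\<And>i. i < n \<Longrightarrow> norm (d i) = 1"
  shows "normalized_basic_norm n (coeff_norm n d)"
proof -
  have 1: "coeff_norm n d a = 0 \<longleftrightarrow> (\<forall>i<n. a i = 0)" for a
  proof
    assume "coeff_norm n d a = 0"
    then have "(\<Sum>i<n. a i *\<^sub>R d i) = 0"
      by (simp add: coeff_norm_def)
    moreover have "(\<Sum>v\<in>d ` {..<n}. a (the_inv_into {..<n} d v) *\<^sub>R v) = (\<Sum>i<n. a i *\<^sub>R d i)"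
      by (subst sum.reindex[OF inj]) (auto intro!: sum.cong simp: the_inv_into_f_f[OF inj])
    ultimately have "(\<Sum>v\<in>d ` {..<n}. a (the_inv_into {..<n} d v) *\<^sub>R v) = 0"
      by simp
    then have *: "a (the_inv_into {..<n} d v) = 0" if "v \<in> d ` {..<n}" for v
      using independentD[OF indep, of "d ` {..<n}" "\<lambda>v. a (the_inv_into {..<n} d v)" v] that
      by simp
    then show "\<forall>i<n. a i = 0"
      using *[OF imageI] by (simp add: the_inv_into_f_f[OF inj])
  qed (simp add: coeff_norm_def)
  have 2: "coeff_norm n d (\<lambda>i. c * a i) = \<bar>c\<bar> * coeff_norm n d a" for c a
    unfolding coeff_norm_def scaleR_scaleR[symmetric] scaleR_sum_right[symmetric] by simp
  have 3: "coeff_norm n d (\<lambda>i. a i + b i) \<le> coeff_norm n d a + coeff_norm n d b" for a b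
    by (simp add: coeff_norm_def scaleR_add_left sum.distrib norm_triangle_ineq)
  have 4: "coeff_norm n d (\<lambda>i. if i = j then 1 else 0) = 1" if "j < n" for j
  proof -
    have "(\<Sum>i<n. (if i = j then 1 else 0) *\<^sub>R d i) = (\<Sum>i<n. if i = j then d i else 0)"
      by (intro sum.cong) auto
    also have "\<dots> = d j"
      using that by simp
    finally show ?thesis
      using that nrm by (simp add: coeff_norm_def)
  qed
  show ?thesis
    unfolding normalized_basic_norm_def using 1 2 3 4 by (auto simp: coeff_norm_def)
qed

text \<open>
  \<open>tail_game z P n []\<close> unfolds to the \<open>n\<close>-fold nested statement: for all \<open>m\<^sub>1\<close> there is
  \<open>y\<^sub>1\<close> in the linear span of the \<open>z i\<close> with \<open>i \<ge> m\<^sub>1\<close>, and so on, for all \<open>m\<^sub>n\<close> there is \<open>y\<^sub>n\<close> in the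
  linear span of the \<open>z i\<close> with \<open>i \<ge> m\<^sub>n\<close>, such that \<open>P [y\<^sub>1, \<dots>, y\<^sub>n]\<close>.
\<close>

primrec tail_game ::
  "(nat \<Rightarrow> 'a::real_vector) \<Rightarrow> ('a list \<Rightarrow> bool) \<Rightarrow> nat \<Rightarrow> 'a list \<Rightarrow> bool" where
  "tail_game z P 0 ys \<longleftrightarrow> P ys"
| "tail_game z P (Suc k) ys \<longleftrightarrow> (\<forall>m. \<exists>y\<in>span (z ` {m..}). tail_game z P k (ys @ [y]))"

definition asymptotic_structure ::
  "(nat \<Rightarrow> 'a::real_normed_vector) \<Rightarrow> nat \<Rightarrow> ((nat \<Rightarrow> real) \<Rightarrow> real) set" where
  "asymptotic_structure z n =
     {N. normalized_basic_norm n N \<and>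
         (\<forall>\<epsilon>>0. tail_game z (\<lambda>ys. C_equivalent (1 + \<epsilon>) (coeff_norm n ((!) ys)) N) n [])}"

text \<open>\<open>(x i)\<close>, \<open>i < n\<close>, is a normalized block basis of \<open>(e i)\<close>, \<open>i \<ge> m\<close>.\<close>

definition normalized_block_basis ::
  "(nat \<Rightarrow> 'a::real_normed_vector) \<Rightarrow> nat \<Rightarrow> nat \<Rightarrow> (nat \<Rightarrow> 'a) \<Rightarrow> bool" where
  "normalized_block_basis e m n x \<longleftrightarrow>
     (\<exists>k::nat \<Rightarrow> nat. m \<le> k 0 \<and>
        (\<forall>i<n. k i < k (Suc i) \<and> x i \<in> span (e ` {k i..<k (Suc i)}) \<and> norm (x i) = 1))"

text \<open>The tail starts at \<open>n - 1\<close> because the 1-based index \<open>n\<close> is the 0-based index \<open>n - 1\<close>.\<close>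

definition asymptotic_lp :: "real \<Rightarrow> (nat \<Rightarrow> 'a::real_normed_vector) \<Rightarrow> bool" where
  "asymptotic_lp p e \<longleftrightarrow>
     basic_sequence e \<and>
     (\<exists>C. \<forall>n\<ge>1. \<forall>x. normalized_block_basis e (n - 1) n x \<longrightarrow>
        C_equivalent C (coeff_norm n x) (lp_coeff_norm p n))"

end

theory Submission
  imports Defs
begin

text \<open>
  The hypothesis controls only sums \<open>\<Sum> d\<^sub>i\<close> with all coefficients equal, and only in the asymptotic
  structure. The proof first finds, in a given subspace \<open>X\<close>, a normalized basic sequence \<open>x\<close> for which
  sums of \<open>n\<close> normalized blocks of its \<open>n\<close>-th tail have norm \<open>n powr (1 / p)\<close> up to a constant
  (\<open>lp_sums\<close>). It then passes to a block sequence of \<open>x\<close> in which a vector can be cut into many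
  small pieces of equal norm, so that unequal coefficients become unequal numbers of pieces.

  For the first part, consider the game in which one player names tails of the basis and the
  other answers with normalized vectors in their spans. The outcomes that the second player cannot
  enforce form an ideal (\<open>tail_game_disj\<close>). Since the norms on \<open>n\<close> coefficients that dominate a fixed
  multiple of the coefficients and are normalized form a compact set, an outcome that can be enforced is
  approximated by a member of the asymptotic structure (\<open>asymptotic_structure_of_game\<close>). Hence the
  second player cannot make the norm of the sum violate the hypothesis, and the first player
  has a strategy that keeps it within bounds (\<open>forces_of_asymptotic_structure\<close>). By compactness of finite
  dimensional balls this strategy can be made independent of the exact position, at a small loss
  (\<open>forces_uniform\<close>), and a sequence chosen in \<open>X\<close> deep enough in the tails follows it for all
  blocks at once (\<open>forces_on_blocks\<close>). Finite codimension of the tails provides the vectors of \<open>X\<close>, and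
  separation from the tails (\<open>tail_separation\<close>) makes them basic. Both rest on the boundedness
  of the basis projections (\<open>proj_bounded\<close>), a consequence of the Baire category theorem.

  For the second part, let \<open>e j\<close> be normalized sums of very many consecutive \<open>x i\<close>
  (\<open>lp_sums_fast_averages\<close>). Every normalized block of the \<open>e j\<close> is a combination of the \<open>x i\<close> with tiny
  coefficients. Given blocks \<open>w l\<close>, \<open>l < n\<close>, and scalars \<open>a l\<close>, each \<open>a l *\<^sub>R w l\<close> is cut greedily into \<open>N l\<close> successive
  pieces of norm close to a small \<open>d\<close> (\<open>greedy_splitting\<close>). The property of \<open>x\<close> gives
  \<open>\<bar>a l\<bar> \<approx> d * N l powr (1 / p)\<close> as well as
  \<open>\<parallel>\<Sum>l. a l *\<^sub>R w l\<parallel> \<approx> d * (\<Sum>l. N l) powr (1 / p)\<close>,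
  and the right hand side is comparable to \<open>(\<Sum>l. \<bar>a l\<bar> powr p) powr (1 / p)\<close>. The number of pieces is bounded in terms of
  \<open>n\<close> (\<open>lp_sums_imp_spread_lp\<close>), so a suitable growth of the sums \<open>e j\<close> suffices.
\<close>

section \<open>The basis constant\<close>

locale schauder =
  fixes z :: "nat \<Rightarrow> 'a::banach"
  assumes basis: "schauder_basis_of z UNIV"
begin

definition coord :: "'a \<Rightarrow> nat \<Rightarrow> real" where
  "coord x = (THE a. (\<lambda>i. a i *\<^sub>R z i) sums x)"

definition proj :: "nat \<Rightarrow> 'a \<Rightarrow> 'a" where
  "proj m x = (\<Sum>i<m. coord x i *\<^sub>R z i)"

abbreviation tail :: "nat \<Rightarrow> 'a set" where
  "tail m \<equiv> closure (span (z ` {m..}))"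

lemma ex1_coord: "\<exists>!a::nat \<Rightarrow> real. (\<lambda>i. a i *\<^sub>R z i) sums x"
  using basis by (auto simp: schauder_basis_of_def)

lemma coord_sums: "(\<lambda>i. coord x i *\<^sub>R z i) sums x"
  unfolding coord_def by (rule theI'[OF ex1_coord])

lemma coord_unique: "(\<lambda>i. a i *\<^sub>R z i) sums x \<Longrightarrow> coord x = a"
  using ex1_coord coord_sums by blast

lemma coord_add: "coord (x + y) i = coord x i + coord y i"
proof -
  have "(\<lambda>i. (coord x i + coord y i) *\<^sub>R z i) sums (x + y)"
    using sums_add[OF coord_sums[of x] coord_sums[of y]] by (simp add: scaleR_add_left)
  from coord_unique[OF this] show ?thesis by simp
qed

lemma coord_scaleR: "coord (r *\<^sub>R x) i = r * coord x i"
proof -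
  have "(\<lambda>i. (r * coord x i) *\<^sub>R z i) sums (r *\<^sub>R x)"
    using sums_scaleR_right[OF coord_sums[of x], of r] by simp
  from coord_unique[OF this] show ?thesis by simp
qed

lemma coord_basis: "coord (z j) i = (if i = j then 1 else 0)"
proof -
  have "(\<lambda>i. (if i = j then 1 else 0::real) *\<^sub>R z i) sums z j"
    using sums_single[of j "\<lambda>i. z i"] by (rule back_subst[where P="\<lambda>f. f sums z j"]) auto
  from coord_unique[OF this] show ?thesis by simp
qed

lemma z_nonzero: "z j \<noteq> 0"
proof
  assume "z j = 0"
  then have "coord (z j) j = 0"
    using coord_scaleR[of 0 "z j" j] by simp
  then show False by (simp add: coord_basis)
qed

lemma linear_proj: "linear (proj m)"
  by (rule linearI) (simp_all add: proj_def coord_add coord_scaleR scaleR_add_left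
      sum.distrib scaleR_sum_right)

lemma proj_tendsto: "(\<lambda>m. proj m x) \<longlonglongrightarrow> x"
  using coord_sums[of x] by (simp add: sums_def proj_def)

lemma proj_Suc_diff: "proj (Suc m) x - proj m x = coord x m *\<^sub>R z m"
  by (simp add: proj_def)

text \<open>
  The closure makes these sets accessible to the Baire category theorem; without it they are
  not known to be closed, because the projections are not yet known to be continuous.
\<close>

definition almost_bounded :: "nat \<Rightarrow> 'a set" where
  "almost_bounded k = closure {x. \<forall>m. norm (proj m x) \<le> real k}"

text \<open>
  The projections converge at every point, so they are bounded at every point, and the sets
  \<open>almost_bounded k\<close> exhaust the space; by Baire one of them has interior points.
\<close>

lemma almost_bounded_interior:
  obtains k x0 r where "0 < r" "ball x0 r \<subseteq> almost_bounded k"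
proof -
  have un: "(\<Union>k. almost_bounded k) = UNIV"
  proof -
    have "x \<in> (\<Union>k. almost_bounded k)" for x
    proof -
      have "Bseq (\<lambda>m. proj m x)"
        using proj_tendsto convergentI Bseq_conv_Bfun convergent_imp_Bseq by blast
      then obtain C where C: "\<And>m. norm (proj m x) \<le> C"
        unfolding Bseq_def by auto
      obtain k where "C \<le> real k" using real_arch_simple by blast
      then have "x \<in> {x. \<forall>m. norm (proj m x) \<le> real k}"
        using C order_trans by blast
      then have "x \<in> almost_bounded k"
        unfolding almost_bounded_def by (rule subsetD[OF closure_subset])
      then show ?thesis by blast
    qed
    then show ?thesis by blast
  qed
  have "\<exists>k. interior (almost_bounded k) \<noteq> {}"
  proof (rule ccontr)
    assume "\<nexists>k. interior (almost_bounded k) \<noteq> {}"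
    then have "Met_TC.mtopology interior_of \<Union>(range almost_bounded) = {}"
      by (intro Met_TC.metric_Baire_category_alt)
        (auto simp: complete_UNIV almost_bounded_def )
    then show False using un by simp
  qed
  then obtain k x0 where "x0 \<in> interior (almost_bounded k)" by blast
  then obtain r where "r > 0" "ball x0 r \<subseteq> almost_bounded k"
    by (meson mem_interior)
  then show ?thesis using that by blast
qed

text \<open>
  Differences of vectors close to an interior point \<open>x0\<close> approximate every vector of a ball around
  \<open>0\<close>; the general case follows by scaling.
\<close>

lemma approximate_with_bounded_projections:
  obtains D where "0 \<le> D"
    "\<And>y. \<exists>w. norm (y - w) \<le> norm y / 2 \<and> (\<forall>m. norm (proj m w) \<le> D * norm y)"
proof -
  obtain k x0 r where r: "0 < r" "ball x0 r \<subseteq> almost_bounded k"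
    by (rule almost_bounded_interior)
  have small: "\<exists>w. norm (y - w) < e \<and> (\<forall>m. norm (proj m w) \<le> 2 * real k)"
    if y: "norm y < r" and e: "e > 0" for y e
  proof -
    have "x0 + y \<in> almost_bounded k" "x0 \<in> almost_bounded k"
      using r y by (auto simp: subset_iff dist_norm)
    then obtain u v where u: "\<forall>m. norm (proj m u) \<le> real k" "dist u (x0 + y) < e/2"
      and v: "\<forall>m. norm (proj m v) \<le> real k" "dist v x0 < e/2"
      unfolding almost_bounded_def closure_approachable using e
      by (metis (mono_tags, lifting) half_gt_zero mem_Collect_eq)
    have "norm (y - (u - v)) = norm ((v - x0) - (u - (x0 + y)))" by (simp add: algebra_simps)
    also have "\<dots> \<le> norm (v - x0) + norm (u - (x0 + y))" by (rule norm_triangle_ineq4)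
    also have "\<dots> < e" using u v by (simp add: dist_norm)
    finally have 1: "norm (y - (u - v)) < e" .
    have "norm (proj m (u - v)) \<le> 2 * real k" for m
    proof -
      have "norm (proj m (u - v)) \<le> norm (proj m u) + norm (proj m v)"
        by (simp add: linear_diff[OF linear_proj] norm_triangle_ineq4)
      also have "\<dots> \<le> real k + real k" using u v by (intro add_mono) auto
      finally show ?thesis by simp
    qed
    then show ?thesis using 1 by blast
  qed
  show ?thesis
  proof (rule that)
    show "0 \<le> 4 * real k / r" using r by simp
    fix y
    show "\<exists>w. norm (y - w) \<le> norm y / 2 \<and> (\<forall>m. norm (proj m w) \<le> 4 * real k / r * norm y)"
    proof (cases "y = 0")
      case True
      then show ?thesis using linear_0[OF linear_proj] by (intro exI[of _ 0]) auto
    next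
      case False
      define t where "t = 2 * norm y / r"
      have t: "t > 0" using False r by (simp add: t_def)
      have "norm ((1/t) *\<^sub>R y) < r" using False r by (simp add: t_def)
      from small[OF this, of "r/4"] r obtain w where
        w: "norm ((1/t) *\<^sub>R y - w) < r/4" "\<forall>m. norm (proj m w) \<le> 2 * real k" by auto
      have "y - t *\<^sub>R w = t *\<^sub>R ((1/t) *\<^sub>R y - w)" using t by (simp add: scaleR_diff_right)
      then have "norm (y - t *\<^sub>R w) = t * norm ((1/t) *\<^sub>R y - w)" using t by simp
      also have "\<dots> \<le> t * (r/4)" using w t by (intro mult_left_mono) auto
      also have "\<dots> = norm y / 2" using r by (simp add: t_def)
      finally have 1: "norm (y - t *\<^sub>R w) \<le> norm y / 2" .
      have "norm (proj m (t *\<^sub>R w)) \<le> 4 * real k / r * norm y" for m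
      proof -
        have "norm (proj m (t *\<^sub>R w)) = t * norm (proj m w)"
          using t by (simp add: linear_scale[OF linear_proj])
        also have "\<dots> \<le> t * (2 * real k)" using w t by (intro mult_left_mono) auto
        also have "\<dots> = 4 * real k / r * norm y" by (simp add: t_def)
        finally show ?thesis .
      qed
      then show ?thesis using 1 by blast
    qed
  qed
qed

text \<open>
  The argument of the open mapping theorem. Approximating again and again what is left of \<open>y\<close>
  yields a series \<open>y = \<Sum>i. w i\<close> for which the norms of \<open>proj m (w i)\<close> decrease geometrically,
  uniformly in \<open>m\<close>. Adding up the coordinates of the \<open>w i\<close> gives an expansion of \<open>y\<close>; by uniqueness of
  expansions its partial sums are the \<open>proj m y\<close>, and they inherit the geometric bound.
\<close>

lemma proj_bounded:
  "\<exists>B\<ge>1. \<forall>m x. norm (proj m x) \<le> B * norm x"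
proof -
  obtain D where D: "0 \<le> D" and
    ex: "\<And>y. \<exists>w. norm (y - w) \<le> norm y / 2 \<and> (\<forall>m. norm (proj m w) \<le> D * norm y)"
    by (rule approximate_with_bounded_projections) blast
  from ex obtain W where W: "\<And>y. norm (y - W y) \<le> norm y / 2"
    "\<And>y m. norm (proj m (W y)) \<le> D * norm y" by metis
  have main: "norm (proj m y) \<le> 2 * D * norm y" for m y
  proof -
    define res where "res = rec_nat y (\<lambda>_ u. u - W u)"
    define w where "w i = W (res i)" for i
    have res0: "res 0 = y" and resS: "res (Suc i) = res i - w i" for i
      by (simp_all add: res_def w_def)
    have res_le: "norm (res i) \<le> norm y * (1/2)^i" for i
    proof (induction i)
      case (Suc i)
      have "norm (res (Suc i)) \<le> norm (res i) / 2" using W(1)[of "res i"] by (simp only: resS w_def)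
      then show ?case using Suc by simp
    qed (simp add: res0)
    have geo: "(\<lambda>i. C * (1/2)^i) sums (2 * C)" for C :: real
      using sums_mult[OF geometric_sums[of "1/2::real"], of C] by (simp add: mult.commute)
    have pw: "norm (proj m (w i)) \<le> D * norm y * (1/2)^i" for m i
    proof -
      have "norm (proj m (w i)) \<le> D * norm (res i)" by (simp add: w_def W)
      also have "\<dots> \<le> D * (norm y * (1/2)^i)" by (intro mult_left_mono res_le D)
      finally show ?thesis by simp
    qed
    have sum_w: "(\<Sum>i<n. w i) = y - res n" for n
      by (induction n) (simp_all add: res0 resS)
    have "res \<longlonglongrightarrow> 0"
    proof (rule tendsto_0_le[where K=1])
      show "(\<lambda>i. norm y * (1/2)^i) \<longlonglongrightarrow> 0"
        by (rule tendsto_mult_right_zero) (simp add: LIMSEQ_realpow_zero)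
      show "\<forall>\<^sub>F i in sequentially. norm (res i) \<le> norm (norm y * (1/2)^i) * 1"
        using res_le by (simp add: abs_mult)
    qed
    then have wy: "w sums y"
      unfolding sums_def sum_w using tendsto_diff[OF tendsto_const[of y]] by fastforce
    have summ: "summable (\<lambda>i. proj m (w i))" for m
      by (rule summable_comparison_test[OF _ sums_summable[OF geo]]) (use pw in blast)
    define S where "S m = (\<Sum>i. proj m (w i))" for m
    have coord_w: "norm (coord (w i) j) \<le> 2 * D * norm y / norm (z j) * (1/2)^i" for i j
    proof -
      have "\<bar>coord (w i) j\<bar> * norm (z j) = norm (proj (Suc j) (w i) - proj j (w i))"
        by (simp add: proj_Suc_diff)
      also have "\<dots> \<le> norm (proj (Suc j) (w i)) + norm (proj j (w i))"
        by (rule norm_triangle_ineq4)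
      also have "\<dots> \<le> 2 * D * norm y * (1/2)^i" using pw[of "Suc j" i] pw[of j i] by simp
      finally show ?thesis using z_nonzero[of j] by (simp add: field_simps)
    qed
    have summ_c: "summable (\<lambda>i. coord (w i) j)" for j
      by (rule summable_comparison_test[OF _ sums_summable[OF geo]]) (use coord_w in blast)
    define a where "a j = (\<Sum>i. coord (w i) j)" for j
    have S_eq: "S m = (\<Sum>j<m. a j *\<^sub>R z j)" for m
    proof -
      have "S m = (\<Sum>j<m. \<Sum>i. coord (w i) j *\<^sub>R z j)"
        unfolding S_def proj_def by (rule suminf_sum) (intro summable_scaleR_left summ_c)
      then show ?thesis by (simp add: a_def suminf_scaleR_left[OF summ_c])
    qed
    \<comment> \<open>\<open>S m\<close>, the candidate for \<open>proj m y\<close>, is approximated uniformly in \<open>m\<close>.\<close>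
    have tail_le: "norm ((\<Sum>i<n. proj m (w i)) - S m) \<le> 2 * (D * norm y * (1/2)^n)" for n m
    proof -
      have "S m - (\<Sum>i<n. proj m (w i)) = (\<Sum>i. proj m (w (i + n)))"
        unfolding S_def using suminf_minus_initial_segment[OF summ[of m], of n] by simp
      also have "norm \<dots> \<le> 2 * (D * norm y * (1/2)^n)"
      proof (rule order_trans[OF norm_suminf_le])
        show "norm (proj m (w (i + n))) \<le> (D * norm y * (1/2)^n) * (1/2)^i" for i
          using pw[of m "i + n"] by (simp add: power_add mult_ac)
        show "summable (\<lambda>i. (D * norm y * (1/2)^n) * (1/2)^i)" using geo sums_summable by blast
        show "(\<Sum>i. (D * norm y * (1/2)^n) * (1/2)^i) \<le> 2 * (D * norm y * (1/2)^n)"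
          using sums_unique[OF geo[of "D * norm y * (1/2)^n"]] by simp
      qed
      finally show ?thesis by (simp add: norm_minus_commute)
    qed
    have "S \<longlonglongrightarrow> y"
    proof (rule LIMSEQ_I)
      fix e :: real assume e: "e > 0"
      have "(\<lambda>n. 2 * (D * norm y * (1/2)^n) + norm y * (1/2)^n) \<longlonglongrightarrow> 2 * (D * norm y * 0) + norm y * 0"
        by (intro tendsto_intros LIMSEQ_realpow_zero) auto
      then have "\<forall>\<^sub>F n in sequentially. 2 * (D * norm y * (1/2)^n) + norm y * (1/2)^n < e/2"
        using order_tendstoD(2)[of _ _ _ "e/2"] e by fastforce
      then obtain n where n: "2 * (D * norm y * (1/2)^n) + norm y * (1/2)^n < e/2"
        unfolding eventually_sequentially by blast
      define u where "u = (\<Sum>i<n. w i)"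
      have pu: "proj m u = (\<Sum>i<n. proj m (w i))" for m
        unfolding u_def by (rule linear_sum[OF linear_proj])
      obtain M where M: "\<And>m. m \<ge> M \<Longrightarrow> norm (proj m u - u) < e/2"
        using LIMSEQ_D[OF proj_tendsto[of u], of "e/2"] e by auto
      have "norm (S m - y) < e" if "m \<ge> M" for m
      proof -
        have "S m - y = (S m - proj m u) + (proj m u - u) + (u - y)" by simp
        also have "norm \<dots> \<le> norm (S m - proj m u) + norm (proj m u - u) + norm (u - y)"
          by (meson add_right_mono norm_triangle_ineq order_trans)
        also have "norm (u - y) \<le> norm y * (1/2)^n" using res_le[of n] by (simp add: u_def sum_w)
        also have "norm (S m - proj m u) \<le> 2 * (D * norm y * (1/2)^n)"
          using tail_le[of m n] by (simp add: pu norm_minus_commute)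
        finally show ?thesis using n M[OF that] by simp
      qed
      then show "\<exists>M. \<forall>m\<ge>M. norm (S m - y) < e" by blast
    qed
    moreover have "S = (\<lambda>m. \<Sum>j<m. a j *\<^sub>R z j)" using S_eq by blast
    ultimately have "(\<lambda>j. a j *\<^sub>R z j) sums y" by (simp add: sums_def)
    then have "coord y = a" by (rule coord_unique)
    then have "proj m y = S m" by (simp add: proj_def S_eq)
    also have "norm (S m) \<le> 2 * D * norm y" using tail_le[of m 0] by simp
    finally show ?thesis .
  qed
  have "norm (proj m x) \<le> max 1 (2 * D) * norm x" for m x
    by (rule order_trans[OF main]) (intro mult_right_mono, auto)
  then show ?thesis by (intro exI[of _ "max 1 (2 * D)"]) auto
qed

definition basis_const :: real where
  "basis_const = (SOME B. 1 \<le> B \<and> (\<forall>m x. norm (proj m x) \<le> B * norm x))"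

lemma basis_const_ge_1: "1 \<le> basis_const" and norm_proj_le: "norm (proj m x) \<le> basis_const * norm x"
  using someI_ex[OF proj_bounded] unfolding basis_const_def by auto

end

section \<open>Basic sequences and tails\<close>

text \<open>
  The coefficients are a function on all indices, so that the same \<open>a\<close> expresses \<open>x\<close> as a sum of
  any sufficiently large length.
\<close>

lemma span_image_coefficients:
  assumes "x \<in> span (e ` I)"
  obtains a :: "nat \<Rightarrow> real" and F where "finite F" "F \<subseteq> I" "\<And>i. i \<notin> F \<Longrightarrow> a i = 0"
    "\<And>m. F \<subseteq> {..<m} \<Longrightarrow> x = (\<Sum>i<m. a i *\<^sub>R e i)"
proof -
  have "\<exists>(a :: nat \<Rightarrow> real) F. finite F \<and> F \<subseteq> I \<and> (\<forall>i. i \<notin> F \<longrightarrow> a i = 0) \<and> x = (\<Sum>i\<in>F. a i *\<^sub>R e i)"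
    using assms
  proof (induction rule: span_induct_alt)
    case base
    show ?case by (intro exI[of _ "\<lambda>_. 0"] exI[of _ "{}"]) auto
  next
    case (step c x y)
    then obtain j and a :: "nat \<Rightarrow> real" and F where j: "j \<in> I" "x = e j" and F: "finite F" "F \<subseteq> I"
      "\<forall>i. i \<notin> F \<longrightarrow> a i = 0" "y = (\<Sum>i\<in>F. a i *\<^sub>R e i)"
      by auto
    have "y = (\<Sum>i\<in>insert j F. a i *\<^sub>R e i)"
      using F by (cases "j \<in> F") (auto simp: insert_absorb)
    moreover have "c *\<^sub>R x = (\<Sum>i\<in>insert j F. (if i = j then c else 0) *\<^sub>R e i)"
    proof -
      have "(\<Sum>i\<in>insert j F. (if i = j then c else 0) *\<^sub>R e i) = (\<Sum>i\<in>{j}. (if i = j then c else 0) *\<^sub>R e i)"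
        by (rule sum.mono_neutral_right) (use F in auto)
      then show ?thesis by (simp add: j)
    qed
    ultimately have "c *\<^sub>R x + y = (\<Sum>i\<in>insert j F. ((if i = j then c else 0) + a i) *\<^sub>R e i)"
      by (simp add: scaleR_add_left sum.distrib)
    then show ?case using F j
      by (intro exI[of _ "\<lambda>i. (if i = j then c else 0) + a i"] exI[of _ "insert j F"]) auto
  qed
  then obtain a :: "nat \<Rightarrow> real" and F where F: "finite F" "F \<subseteq> I" "\<And>i. i \<notin> F \<Longrightarrow> a i = 0"
    "x = (\<Sum>i\<in>F. a i *\<^sub>R e i)" by blast
  have "x = (\<Sum>i<m. a i *\<^sub>R e i)" if "F \<subseteq> {..<m}" for m
    unfolding F(4) by (rule sum.mono_neutral_left) (use F that in auto)
  with F that show ?thesis by blast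
qed

definition initial_bounded :: "real \<Rightarrow> (nat \<Rightarrow> 'a::real_normed_vector) \<Rightarrow> bool" where
  "initial_bounded B e \<longleftrightarrow>
     (\<forall>a q r. q \<le> r \<longrightarrow> coeff_norm q e a \<le> B * coeff_norm r e a)"

lemma initial_bounded_term:
  assumes "initial_bounded B e" "i < r"
  shows "\<bar>a i\<bar> * norm (e i) \<le> 2 * B * coeff_norm r e a"
proof -
  have "\<bar>a i\<bar> * norm (e i) = norm ((\<Sum>j<Suc i. a j *\<^sub>R e j) - (\<Sum>j<i. a j *\<^sub>R e j))" by simp
  also have "\<dots> \<le> coeff_norm (Suc i) e a + coeff_norm i e a"
    unfolding coeff_norm_def by (rule norm_triangle_ineq4)
  also have "coeff_norm (Suc i) e a \<le> B * coeff_norm r e a"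
    using assms by (auto simp: initial_bounded_def)
  also have "coeff_norm i e a \<le> B * coeff_norm r e a"
    using assms by (auto simp: initial_bounded_def)
  finally show ?thesis by simp
qed

text \<open>
  The converse of the existence of a basis constant. Expansions of vectors \<open>u k\<close> in the linear
  span have coefficients that are Cauchy in \<open>k\<close> when the \<open>u k\<close> are; since the estimates are uniform in the
  length of the initial segment, the limit coefficients expand the limit of the \<open>u k\<close>.
\<close>

lemma initial_bounded_imp_basic:
  fixes e :: "nat \<Rightarrow> 'a::banach"
  assumes nrm: "\<And>i. norm (e i) = 1" and ib: "initial_bounded B e"
  shows "basic_sequence e"
  unfolding basic_sequence_def schauder_basis_of_def
proof (intro conjI ballI)
  show "range e \<subseteq> closure (span (range e))"
    by (meson closure_subset order_trans span_superset)
  have B: "0 \<le> B"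
    using initial_bounded_term[OF ib, of 0 1 "\<lambda>_. 1"] nrm by (simp add: coeff_norm_def)
  fix x assume x: "x \<in> closure (span (range e))"
  have unique: "a = b" if a: "(\<lambda>i. a i *\<^sub>R e i) sums x" and b: "(\<lambda>i. b i *\<^sub>R e i) sums x" for a b
  proof
    fix i
    have s: "(\<lambda>i. (a i - b i) *\<^sub>R e i) sums 0"
      using sums_diff[OF a b] by (simp add: scaleR_diff_left)
    have "(\<lambda>r. 2 * B * coeff_norm r e (\<lambda>i. a i - b i)) \<longlonglongrightarrow> 2 * B * norm (0::'a)"
      using s unfolding sums_def coeff_norm_def by (intro tendsto_intros)
    moreover have "\<forall>\<^sub>F r in sequentially. \<bar>a i - b i\<bar> \<le> 2 * B * coeff_norm r e (\<lambda>i. a i - b i)"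
      using initial_bounded_term[OF ib, of i _ "\<lambda>i. a i - b i"] nrm
      by (intro eventually_sequentiallyI[of "Suc i"]) auto
    ultimately have "\<bar>a i - b i\<bar> \<le> 2 * B * norm (0::'a)"
      by (intro tendsto_lowerbound) auto
    then show "a i = b i" by simp
  qed
  obtain u where u: "\<And>k. u k \<in> span (range e)" "u \<longlonglongrightarrow> x"
    using x unfolding closure_sequential by blast
  have "\<exists>(a::nat \<Rightarrow> real) n. \<forall>m\<ge>n. u k = (\<Sum>i<m. a i *\<^sub>R e i)" for k
  proof -
    obtain a :: "nat \<Rightarrow> real" and F where F: "finite F"
      "\<And>m. F \<subseteq> {..<m} \<Longrightarrow> u k = (\<Sum>i<m. a i *\<^sub>R e i)"
      using span_image_coefficients[OF u(1)[of k]] by metis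
    obtain n where "\<forall>i\<in>F. i < n" using F(1) finite_nat_set_iff_bounded by blast
    then show ?thesis by (intro exI[of _ a] exI[of _ n]) (auto intro!: F(2))
  qed
  then obtain a :: "nat \<Rightarrow> nat \<Rightarrow> real" and n where an: "\<And>k m. m \<ge> n k \<Longrightarrow> u k = (\<Sum>i<m. a k i *\<^sub>R e i)"
    by metis
  have diff: "coeff_norm q e (\<lambda>i. a k i - a l i) \<le> B * norm (u k - u l)" for q k l
  proof -
    define r where "r = max q (max (n k) (n l))"
    have "coeff_norm q e (\<lambda>i. a k i - a l i) \<le> B * coeff_norm r e (\<lambda>i. a k i - a l i)"
      using ib by (auto simp: initial_bounded_def r_def)
    also have "coeff_norm r e (\<lambda>i. a k i - a l i) = norm (u k - u l)"
      using an[of k r] an[of l r]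
      by (simp add: r_def coeff_norm_def scaleR_diff_left sum_subtractf)
    finally show ?thesis .
  qed
  have coef_diff: "\<bar>a k i - a l i\<bar> \<le> 2 * B * norm (u k - u l)" for i k l
  proof -
    have "\<bar>a k i - a l i\<bar> \<le> 2 * B * coeff_norm (max (Suc i) (max (n k) (n l))) e (\<lambda>i. a k i - a l i)"
      using initial_bounded_term[OF ib, of i _ "\<lambda>i. a k i - a l i"] nrm by simp
    also have "coeff_norm (max (Suc i) (max (n k) (n l))) e (\<lambda>i. a k i - a l i) = norm (u k - u l)"
      using an[of k "max (Suc i) (max (n k) (n l))"] an[of l "max (Suc i) (max (n k) (n l))"]
      by (simp add: coeff_norm_def scaleR_diff_left sum_subtractf)
    finally show ?thesis .
  qed
  have "\<exists>b. (\<lambda>k. a k i) \<longlonglongrightarrow> b" for i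
  proof -
    have "Cauchy (\<lambda>k. a k i)"
    proof (rule metric_CauchyI)
      fix \<epsilon> :: real assume \<epsilon>: "\<epsilon> > 0"
      have "Cauchy u" using u(2) LIMSEQ_imp_Cauchy by blast
      then obtain M where M: "\<And>k l. k \<ge> M \<Longrightarrow> l \<ge> M \<Longrightarrow> dist (u k) (u l) < \<epsilon> / (2 * B + 1)"
        using metric_CauchyD[of u "\<epsilon> / (2 * B + 1)"] \<epsilon> B by (metis add_nonneg_pos divide_pos_pos
            mult_nonneg_nonneg zero_le_numeral zero_less_one)
      have "dist (a k i) (a l i) < \<epsilon>" if "k \<ge> M" "l \<ge> M" for k l
      proof -
        have "dist (a k i) (a l i) \<le> 2 * B * norm (u k - u l)"
          using coef_diff[of k i l] by (simp add: dist_real_def)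
        also have "\<dots> \<le> (2 * B + 1) * norm (u k - u l)" by (intro mult_right_mono) auto
        also have "\<dots> < \<epsilon>" using M[OF that] B by (simp add: dist_norm field_simps)
        finally show ?thesis .
      qed
      then show "\<exists>M. \<forall>k\<ge>M. \<forall>l\<ge>M. dist (a k i) (a l i) < \<epsilon>" by blast
    qed
    then show ?thesis using Cauchy_convergent convergent_def by blast
  qed
  then obtain b where b: "\<And>i. (\<lambda>k. a k i) \<longlonglongrightarrow> b i" by metis
  have lim: "coeff_norm q e (\<lambda>i. a k i - b i) \<le> B * norm (u k - x)" for q k
  proof (rule LIMSEQ_le)
    show "(\<lambda>l. coeff_norm q e (\<lambda>i. a k i - a l i)) \<longlonglongrightarrow> coeff_norm q e (\<lambda>i. a k i - b i)"
      unfolding coeff_norm_def by (intro tendsto_intros b)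
    show "(\<lambda>l. B * norm (u k - u l)) \<longlonglongrightarrow> B * norm (u k - x)"
      by (intro tendsto_intros u)
  qed (use diff in blast)
  have "(\<lambda>i. b i *\<^sub>R e i) sums x"
    unfolding sums_def
  proof (rule LIMSEQ_I)
    fix \<epsilon> :: real assume \<epsilon>: "\<epsilon> > 0"
    have pos: "\<epsilon> / (B + 1) > 0" using \<epsilon> B by simp
    obtain k where k: "norm (u k - x) < \<epsilon> / (B + 1)"
      using LIMSEQ_D[OF u(2) pos] by blast
    have "norm ((\<Sum>i<m. b i *\<^sub>R e i) - x) < \<epsilon>" if m: "m \<ge> n k" for m
    proof -
      have "(\<Sum>i<m. b i *\<^sub>R e i) - x = (u k - x) - (\<Sum>i<m. (a k i - b i) *\<^sub>R e i)"
        using an[OF m] by (simp add: scaleR_diff_left sum_subtractf)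
      also have "norm \<dots> \<le> norm (u k - x) + coeff_norm m e (\<lambda>i. a k i - b i)"
        unfolding coeff_norm_def by (rule norm_triangle_ineq4)
      also have "\<dots> \<le> (B + 1) * norm (u k - x)" using lim[of m k] by (simp add: algebra_simps)
      also have "\<dots> < \<epsilon>" using k B by (simp add: field_simps)
      finally show ?thesis .
    qed
    then show "\<exists>M. \<forall>m\<ge>M. norm ((\<Sum>i<m. b i *\<^sub>R e i) - x) < \<epsilon>" by blast
  qed
  with unique show "\<exists>!a. (\<lambda>i. a i *\<^sub>R e i) sums x" by blast
qed

text \<open>
  A quantitative form of linear independence, for the supremum norm on coefficients.
\<close>

definition coefs_controlled :: "real \<Rightarrow> nat \<Rightarrow> (nat \<Rightarrow> 'a::real_normed_vector) \<Rightarrow> bool" where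
  "coefs_controlled C n x \<longleftrightarrow> (\<forall>a. \<forall>j<n. \<bar>a j\<bar> \<le> C * coeff_norm n x a)"

lemma coeff_norm_nonneg [simp]: "0 \<le> coeff_norm n x a"
  by (simp add: coeff_norm_def)

lemma coefs_controlled_Suc:
  assumes c: "coefs_controlled ((1 + D) ^ n) n x" and D: "0 \<le> D" and nrm: "norm (x n) = 1"
    and sep: "\<And>a. coeff_norm n x a \<le> D * coeff_norm (Suc n) x a"
  shows "coefs_controlled ((1 + D) ^ Suc n) (Suc n) x"
  unfolding coefs_controlled_def
proof (intro allI impI)
  fix a :: "nat \<Rightarrow> real" and j assume "j < Suc n"
  then consider "j < n" | "j = n" by linarith
  then show "\<bar>a j\<bar> \<le> (1 + D) ^ Suc n * coeff_norm (Suc n) x a"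
  proof cases
    case 1
    then have "\<bar>a j\<bar> \<le> (1 + D) ^ n * coeff_norm n x a" using c by (auto simp: coefs_controlled_def)
    also have "\<dots> \<le> (1 + D) ^ n * (D * coeff_norm (Suc n) x a)"
      using D by (intro mult_left_mono sep) auto
    also have "\<dots> \<le> (1 + D) ^ n * ((1 + D) * coeff_norm (Suc n) x a)"
      using D by (intro mult_left_mono mult_right_mono) auto
    finally show ?thesis by (simp add: mult_ac)
  next
    case 2
    have "\<bar>a j\<bar> = norm ((\<Sum>i<Suc n. a i *\<^sub>R x i) - (\<Sum>i<n. a i *\<^sub>R x i))"
      using 2 nrm by simp
    also have "\<dots> \<le> coeff_norm (Suc n) x a + coeff_norm n x a"
      unfolding coeff_norm_def by (rule norm_triangle_ineq4)
    also have "\<dots> \<le> (1 + D) * coeff_norm (Suc n) x a" using sep[of a] by (simp add: algebra_simps)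
    also have "\<dots> \<le> (1 + D) ^ Suc n * coeff_norm (Suc n) x a"
      using D by (intro mult_right_mono self_le_power) auto
    finally show ?thesis .
  qed
qed

context schauder
begin

lemma bounded_linear_proj: "bounded_linear (proj m)"
  using norm_proj_le by (intro bounded_linear_intro[where K=basis_const])
    (auto simp: linear_add[OF linear_proj] linear_scale[OF linear_proj] mult.commute)

lemma proj_basis: "proj m (z i) = (if i < m then z i else 0)"
proof -
  have "proj m (z i) = (\<Sum>j<m. if j = i then z i else 0)"
    unfolding proj_def coord_basis by (rule sum.cong) auto
  then show ?thesis by simp
qed

lemma proj_tail: "v \<in> tail m \<Longrightarrow> proj m v = 0"
proof -
  have "closed {v. proj m v = 0}"
    by (intro closed_Collect_eq continuous_on_const
        linear_continuous_on[OF bounded_linear_proj])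
  moreover have "span (z ` {m..}) \<subseteq> {v. proj m v = 0}"
    by (rule span_minimal) (auto simp: proj_basis linear_subspace_kernel[OF linear_proj])
  ultimately show "v \<in> tail m \<Longrightarrow> proj m v = 0"
    using closure_minimal by blast
qed

lemma proj_0_imp_tail:
  assumes "proj m x = 0"
  shows "x \<in> tail m"
  unfolding closure_sequential
proof (intro exI conjI allI)
  show "(\<lambda>k. proj (k + m) x) \<longlonglongrightarrow> x"
    by (rule LIMSEQ_ignore_initial_segment[OF proj_tendsto])
  show "proj (k + m) x \<in> span (z ` {m..})" for k
  proof (induction k)
    case 0
    then show ?case using assms by (simp add: span_zero)
  next
    case (Suc k)
    have "proj (Suc k + m) x = proj (k + m) x + coord x (k + m) *\<^sub>R z (k + m)"
      using proj_Suc_diff[of "k + m" x] by (simp add: algebra_simps)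
    then show ?case using Suc by (simp add: span_add span_scale span_base)
  qed
qed

lemma tail_antimono: "m \<le> n \<Longrightarrow> tail n \<subseteq> tail m"
  by (intro closure_mono span_mono) auto

lemma subspace_tail: "subspace (tail m)"
proof -
  have "tail m = {v. proj m v = 0}" using proj_tail proj_0_imp_tail by blast
  then show ?thesis using linear_subspace_kernel[OF linear_proj] by simp
qed

text \<open>
  A projection of finite rank cannot be injective on an infinite dimensional subspace, and the
  kernel of \<open>proj m\<close> is the tail.
\<close>

lemma unit_vector_in_tail:
  assumes X: "subspace X" and inf: "infinite_dimensional X"
  obtains x where "x \<in> X" "x \<in> tail m" "norm x = 1"
proof -
  obtain b where b: "b \<subseteq> X" "independent b" "X \<subseteq> span b"
    by (rule maximal_independent_subset)
  have sp: "span b = X" using b X by (simp add: span_minimal subset_antisym)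
  have "\<not> inj_on (proj m) X"
  proof
    assume inj: "inj_on (proj m) X"
    have "independent (proj m ` b)"
      using linear_independent_injective_image[OF linear_proj b(2)] inj sp by blast
    moreover have "proj m ` b \<subseteq> span (z ` {..<m})"
      unfolding proj_def by (intro image_subsetI span_sum span_scale span_base imageI) simp
    ultimately have "finite (proj m ` b)"
      using independent_span_bound[of "z ` {..<m}"] by blast
    then have "finite b" using inj_on_subset[OF inj b(1)] by (rule finite_imageD)
    then show False using inf sp unfolding infinite_dimensional_def by blast
  qed
  then obtain u where u: "u \<in> X" "u \<noteq> 0" "proj m u = 0"
    using linear_injective_on_subspace_0[OF linear_proj X] by blast
  show ?thesis
  proof (rule that)
    show "(1 / norm u) *\<^sub>R u \<in> X" using u X by (simp add: subspace_scale)
    show "(1 / norm u) *\<^sub>R u \<in> tail m"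
      using proj_0_imp_tail[OF u(3)] subspace_tail subspace_scale by blast
    show "norm ((1 / norm u) *\<^sub>R u) = 1" using u by simp
  qed
qed

text \<open>
  Mazur's argument. On combinations of finitely many vectors with controlled coefficients,
  \<open>P = proj m\<close> with large \<open>m\<close> moves no vector \<open>s\<close> by more than half its norm, and it kills the tail; so
  \<open>\<parallel>s\<parallel> \<le> 2 \<parallel>P s\<parallel> = 2 \<parallel>P (s + v)\<parallel>\<close> for \<open>v\<close> in the tail.
\<close>

lemma tail_separation:
  assumes c: "coefs_controlled C n x"
  obtains m0 where "\<And>m a v. m0 \<le> m \<Longrightarrow> v \<in> tail m \<Longrightarrow>
    coeff_norm n x a \<le> 2 * basis_const * norm ((\<Sum>i<n. a i *\<^sub>R x i) + v)"
proof -
  define d where "d = 1 / (2 * (real n * \<bar>C\<bar> + 1))"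
  have d: "d > 0" by (auto simp: d_def intro!: divide_pos_pos add_nonneg_pos)
  have "\<forall>i<n. \<exists>M. \<forall>m\<ge>M. norm (proj m (x i) - x i) < d"
    using LIMSEQ_D[OF proj_tendsto d] by blast
  then obtain M where M: "\<And>i m. i < n \<Longrightarrow> m \<ge> M i \<Longrightarrow> norm (proj m (x i) - x i) < d" by metis
  define m0 where "m0 = (\<Sum>i<n. M i)"
  have M_le: "M i \<le> m0" if "i < n" for i
    unfolding m0_def by (rule member_le_sum) (use that in auto)
  show ?thesis
  proof (rule that)
    fix m a v assume m: "m0 \<le> m" and v: "v \<in> tail m"
    define s where "s = (\<Sum>i<n. a i *\<^sub>R x i)"
    have "s - proj m s = (\<Sum>i<n. a i *\<^sub>R (x i - proj m (x i)))"
      by (simp add: s_def linear_sum[OF linear_proj] linear_scale[OF linear_proj]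
          scaleR_diff_right sum_subtractf)
    also have "norm \<dots> \<le> (\<Sum>i<n. \<bar>C\<bar> * norm s * d)"
    proof (rule order_trans[OF norm_sum] , rule sum_mono)
      fix i assume i: "i \<in> {..<n}"
      have "\<bar>a i\<bar> \<le> C * norm s" using c i by (auto simp: coefs_controlled_def coeff_norm_def s_def)
      also have "\<dots> \<le> \<bar>C\<bar> * norm s" by (intro mult_right_mono) auto
      finally have 1: "\<bar>a i\<bar> \<le> \<bar>C\<bar> * norm s" .
      have "norm (x i - proj m (x i)) \<le> d"
        using M[of i m] M_le[of i] m i by (simp add: norm_minus_commute)
      then show "norm (a i *\<^sub>R (x i - proj m (x i))) \<le> \<bar>C\<bar> * norm s * d"
        using 1 by (simp add: mult_mono)
    qed
    also have "\<dots> = norm s * (real n * \<bar>C\<bar> * d)" by simp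
    also have "\<dots> \<le> norm s * (1/2)"
      by (intro mult_left_mono) (auto simp: d_def divide_simps add_nonneg_pos)
    finally have "norm (s - proj m s) \<le> norm s / 2" by simp
    moreover have "norm s \<le> norm (s - proj m s) + norm (proj m s)"
      using norm_triangle_ineq[of "s - proj m s" "proj m s"] by simp
    moreover have "norm (proj m s) \<le> basis_const * norm (s + v)"
      using norm_proj_le[of m "s + v"] by (simp add: linear_add[OF linear_proj] proj_tail[OF v])
    ultimately show "coeff_norm n x a \<le> 2 * basis_const * norm ((\<Sum>i<n. a i *\<^sub>R x i) + v)"
      by (simp add: coeff_norm_def s_def)
  qed
qed

end

section \<open>The game and limits of coefficient norms\<close>

lemma span_tail_antimono: "(m::nat) \<le> n \<Longrightarrow> y \<in> span (z ` {n..}) \<Longrightarrow> y \<in> span (z ` {m..})"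
  by (rule subsetD[OF span_mono[OF image_mono], of "{n..}"]) auto

lemma tail_game_mono:
  "tail_game z P k ys \<Longrightarrow> (\<And>ys. P ys \<Longrightarrow> Q ys) \<Longrightarrow> tail_game z Q k ys"
  by (induction k arbitrary: ys) (simp, fastforce)

lemma not_tail_game_False: "\<not> tail_game z (\<lambda>_. False) k ys"
  by (induction k arbitrary: ys) auto

lemma tail_game_length:
  "tail_game z P k ys \<Longrightarrow> tail_game z (\<lambda>ys'. P ys' \<and> length ys' = length ys + k) k ys"
proof (induction k arbitrary: ys)
  case (Suc k)
  show ?case
  proof (clarsimp)
    fix m
    obtain y where y: "y \<in> span (z ` {m..})" "tail_game z P k (ys @ [y])" using Suc.prems by auto
    from Suc.IH[OF y(2)] y(1) show "\<exists>y\<in>span (z ` {m..}). tail_game z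
         (\<lambda>ys'. P ys' \<and> length ys' = Suc (length ys + k)) k (ys @ [y])"
      by auto
  qed
qed simp

text \<open>
  The Ramsey property of the game: failing to reach \<open>P\<close> from tail \<open>m1\<close> on and \<open>Q\<close> from tail \<open>m2\<close> on
  means failing to reach either from the smaller tail \<open>max m1 m2\<close> on. In other words, the
  outcomes that cannot be enforced form an ideal.
\<close>

lemma tail_game_disj:
  "tail_game z (\<lambda>ys. P ys \<or> Q ys) k ys \<Longrightarrow> tail_game z P k ys \<or> tail_game z Q k ys"
proof (induction k arbitrary: ys)
  case (Suc k)
  show ?case
  proof (rule ccontr)
    assume "\<not> (tail_game z P (Suc k) ys \<or> tail_game z Q (Suc k) ys)"
    then obtain m1 m2 where
      1: "\<forall>y\<in>span (z ` {m1..}). \<not> tail_game z P k (ys @ [y])" and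
      2: "\<forall>y\<in>span (z ` {m2..}). \<not> tail_game z Q k (ys @ [y])" by auto
    obtain y where y: "y \<in> span (z ` {max m1 m2..})" "tail_game z (\<lambda>ys. P ys \<or> Q ys) k (ys @ [y])"
      using Suc.prems by auto
    have "y \<in> span (z ` {m1..})" "y \<in> span (z ` {m2..})"
      by (rule span_tail_antimono[OF _ y(1)], simp)+
    with 1 2 Suc.IH[OF y(2)] show False by blast
  qed
qed simp

lemma tail_game_finite_cover:
  assumes "finite F" "tail_game z P k ys" "\<And>ys. P ys \<Longrightarrow> \<exists>i\<in>F. R i ys"
  obtains i where "i \<in> F" "tail_game z (\<lambda>ys. P ys \<and> R i ys) k ys"
proof -
  have "tail_game z (\<lambda>ys. \<exists>i\<in>F. P ys \<and> R i ys) k ys"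
    using assms(2) by (rule tail_game_mono) (use assms(3) in blast)
  with \<open>finite F\<close> have "\<exists>i\<in>F. tail_game z (\<lambda>ys. P ys \<and> R i ys) k ys"
  proof (induction F)
    case empty
    then show ?case using not_tail_game_False[of z k ys] by simp
  next
    case (insert i F)
    have "tail_game z (\<lambda>ys. (P ys \<and> R i ys) \<or> (\<exists>i\<in>F. P ys \<and> R i ys)) k ys"
      using insert.prems by (rule tail_game_mono) blast
    from tail_game_disj[OF this] insert.IH show ?case by blast
  qed
  with that show ?thesis by blast
qed

text \<open>
  If every point of the compact set \<open>S\<close> had a neighbourhood into which \<open>f\<close> cannot be steered,
  finitely many of them would cover \<open>S\<close>, against the Ramsey property.
\<close>

lemma tail_game_cluster_point:
  fixes f :: "'a::real_vector list \<Rightarrow> 'b::topological_space"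
  assumes g: "tail_game z P k ys" and comp: "compact S" and fS: "\<And>ys. P ys \<Longrightarrow> f ys \<in> S"
  obtains N where "N \<in> S"
    "\<And>U. open U \<Longrightarrow> N \<in> U \<Longrightarrow> tail_game z (\<lambda>ys. P ys \<and> f ys \<in> U) k ys"
proof (rule ccontr)
  assume "\<not> thesis"
  then have "\<forall>N\<in>S. \<exists>U. open U \<and> N \<in> U \<and> \<not> tail_game z (\<lambda>ys. P ys \<and> f ys \<in> U) k ys"
    using that by blast
  then obtain U where U: "\<And>N. N \<in> S \<Longrightarrow> open (U N) \<and> N \<in> U N \<and>
      \<not> tail_game z (\<lambda>ys. P ys \<and> f ys \<in> U N) k ys" by metis
  obtain C where C: "C \<subseteq> S" "finite C" "S \<subseteq> (\<Union>c\<in>C. U c)"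
    using compactE_image[OF comp, of S U] U by blast
  obtain N where "N \<in> C" "tail_game z (\<lambda>ys. P ys \<and> f ys \<in> U N) k ys"
    using tail_game_finite_cover[OF C(2) g, of "\<lambda>N ys. f ys \<in> U N"] fS C(3) by blast
  then show False using U C(1) by blast
qed

lemma tail_game_cluster_point_closed:
  assumes N: "\<And>U. open U \<Longrightarrow> N \<in> U \<Longrightarrow> tail_game z (\<lambda>ys. P ys \<and> f ys \<in> U) k ys"
    and cl: "closed T" and PT: "\<And>ys. P ys \<Longrightarrow> f ys \<in> T"
  shows "N \<in> T"
proof (rule ccontr)
  assume "N \<notin> T"
  then have "tail_game z (\<lambda>ys. P ys \<and> f ys \<in> - T) k ys" using N[of "- T"] cl by (simp add: open_Compl)
  then have "tail_game z (\<lambda>_. False) k ys" by (rule tail_game_mono) (use PT in auto)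
  then show False using not_tail_game_False by blast
qed

text \<open>
  Tychonoff's theorem. Coefficient norms live in such a box, which replaces the compactness of the
  set of norms on a finite dimensional space.
\<close>

lemma compact_box:
  fixes l u :: "'i \<Rightarrow> real"
  shows "compact {f. \<forall>i. f i \<in> {l i..u i}}"
proof -
  have "compactin (product_topology (\<lambda>i. euclidean) UNIV) (PiE UNIV (\<lambda>i. {l i..u i}))"
    by (subst compactin_PiE) (auto simp: compactin_euclidean_iff)
  then show ?thesis
    by (simp add: euclidean_product_topology compactin_euclidean_iff PiE_UNIV_domain Pi_def)
qed

lemma coeff_norm_le_sum:
  assumes "\<And>i. i < n \<Longrightarrow> norm (x i) = 1"
  shows "coeff_norm n x a \<le> (\<Sum>i<n. \<bar>a i\<bar>)"
  unfolding coeff_norm_def by (rule order_trans[OF norm_sum], rule sum_mono) (use assms in auto)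

lemma coeff_norm_triangle:
  "coeff_norm n x (\<lambda>i. a i + b i) \<le> coeff_norm n x a + coeff_norm n x b"
  by (simp add: coeff_norm_def scaleR_add_left sum.distrib norm_triangle_ineq)

lemma coeff_norm_scale: "coeff_norm n x (\<lambda>i. c * a i) = \<bar>c\<bar> * coeff_norm n x a"
  unfolding coeff_norm_def scaleR_scaleR[symmetric] scaleR_sum_right[symmetric] by simp

lemma coeff_norm_unit:
  assumes "j < n" "norm (x j) = 1"
  shows "coeff_norm n x (\<lambda>i. if i = j then 1 else 0) = 1"
proof -
  have "(\<Sum>i<n. (if i = j then 1 else 0) *\<^sub>R x i) = (\<Sum>i<n. if i = j then x i else 0)"
    by (intro sum.cong) auto
  then show ?thesis using assms by (simp add: coeff_norm_def)
qed

text \<open>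
  The properties that pass from the coefficient norms of normalized vectors to their pointwise
  limits; definiteness of a limit needs a uniform lower bound in addition.
\<close>

definition dominated_seminorm :: "nat \<Rightarrow> ((nat \<Rightarrow> real) \<Rightarrow> real) \<Rightarrow> bool" where
  "dominated_seminorm n N \<longleftrightarrow>
     (\<forall>a. 0 \<le> N a \<and> N a \<le> (\<Sum>i<n. \<bar>a i\<bar>)) \<and>
     (\<forall>c a. N (\<lambda>i. c * a i) = \<bar>c\<bar> * N a) \<and>
     (\<forall>a b. N (\<lambda>i. a i + b i) \<le> N a + N b)"

lemma dominated_seminormD:
  assumes "dominated_seminorm n N"
  shows "0 \<le> N a" "N a \<le> (\<Sum>i<n. \<bar>a i\<bar>)" "N (\<lambda>i. c * a i) = \<bar>c\<bar> * N a"
    "N (\<lambda>i. a i + b i) \<le> N a + N b"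
  using assms unfolding dominated_seminorm_def by simp_all

lemma dominated_seminorm_coeff_norm:
  "(\<And>i. i < n \<Longrightarrow> norm (x i) = 1) \<Longrightarrow> dominated_seminorm n (coeff_norm n x)"
  by (simp add: dominated_seminorm_def coeff_norm_le_sum coeff_norm_triangle coeff_norm_scale)

lemma dominated_seminorm_diff:
  assumes N: "dominated_seminorm n N" and ab: "\<And>i. i < n \<Longrightarrow> \<bar>a i - b i\<bar> \<le> d"
  shows "\<bar>N a - N b\<bar> \<le> real n * d"
proof -
  have *: "N u - N v \<le> real n * d" if "\<And>i. i < n \<Longrightarrow> \<bar>u i - v i\<bar> \<le> d" for u v
  proof -
    have "N u = N (\<lambda>i. (u i - v i) + v i)" by simp
    also have "\<dots> \<le> N (\<lambda>i. u i - v i) + N v" by (rule dominated_seminormD(4)[OF N])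
    also have "N (\<lambda>i. u i - v i) \<le> (\<Sum>i<n. \<bar>u i - v i\<bar>)" by (rule dominated_seminormD(2)[OF N])
    also have "\<dots> \<le> (\<Sum>i<n. d)" by (rule sum_mono) (use that in auto)
    finally show ?thesis by simp
  qed
  show ?thesis using *[of a b] *[of b a] ab by (simp add: abs_le_iff abs_minus_commute)
qed

lemma finite_coefficient_net:
  assumes d: "0 < d"
  obtains F :: "(nat \<Rightarrow> real) set" where "finite F"
    "\<And>a. (\<And>i. i < n \<Longrightarrow> \<bar>a i\<bar> \<le> 1) \<Longrightarrow> \<exists>b\<in>F. \<forall>i<n. \<bar>a i - b i\<bar> \<le> d"
proof -
  define M where "M = \<lceil>1 / d\<rceil>"
  define G where "G = (\<lambda>k::int. real_of_int k * d) ` {-M - 1..M}"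
  define F where "F = PiE {..<n} (\<lambda>_. G)"
  show ?thesis
  proof (rule that)
    show "finite F" unfolding F_def G_def by (intro finite_PiE) auto
    fix a :: "nat \<Rightarrow> real" assume a: "\<And>i. i < n \<Longrightarrow> \<bar>a i\<bar> \<le> 1"
    define b where "b = restrict (\<lambda>i. real_of_int \<lfloor>a i / d\<rfloor> * d) {..<n}"
    have "\<lfloor>a i / d\<rfloor> \<in> {-M - 1..M}" if "i < n" for i
    proof -
      have "\<bar>a i / d\<bar> \<le> 1 / d" using a[OF that] d by (simp add: divide_right_mono)
      moreover have "1 / d \<le> real_of_int M" by (simp add: M_def)
      ultimately have "a i / d \<le> real_of_int M" "- real_of_int M \<le> a i / d" by linarith+
      then show ?thesis by (simp add: floor_le_iff le_floor_iff)
    qed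
    then have "b \<in> F" by (auto simp: F_def G_def b_def)
    moreover have "\<bar>a i - b i\<bar> \<le> d" if "i < n" for i
    proof -
      have f1: "real_of_int \<lfloor>a i / d\<rfloor> \<le> a i / d" "a i / d < real_of_int \<lfloor>a i / d\<rfloor> + 1" by linarith+
      have "real_of_int \<lfloor>a i / d\<rfloor> * d \<le> a i" "a i \<le> real_of_int \<lfloor>a i / d\<rfloor> * d + d"
        using mult_right_mono[OF f1(1), of d] mult_strict_right_mono[OF f1(2) d] d
        by (simp_all add: algebra_simps)
      then show ?thesis using that by (simp add: b_def)
    qed
    ultimately show "\<exists>b\<in>F. \<forall>i<n. \<bar>a i - b i\<bar> \<le> d" by blast
  qed
qed

text \<open>
  A seminorm dominated by the \<open>\<ell>\<^sub>1\<close> norm is Lipschitz, so closeness on a finite net of coefficients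
  gives uniform closeness on the unit ball of the supremum norm, and the lower bound on \<open>N\<close> turns this
  additive estimate into a multiplicative one.
\<close>

lemma pointwise_close_imp_C_equivalent:
  assumes N: "dominated_seminorm n N" and low: "\<And>a j. j < n \<Longrightarrow> \<bar>a j\<bar> \<le> C * N a"
    and eps: "0 < \<epsilon>"
  obtains U where "open U" "N \<in> U"
    "\<And>M. dominated_seminorm n M \<Longrightarrow> M \<in> U \<Longrightarrow> C_equivalent (1 + \<epsilon>) M N"
proof -
  define D where "D = max C 1"
  have D: "D \<ge> 1" by (simp add: D_def)
  have lowD: "\<bar>a j\<bar> \<le> D * N a" if "j < n" for a j
  proof -
    have "C * N a \<le> D * N a" using N by (intro mult_right_mono) (auto simp: D_def dominated_seminorm_def)
    then show ?thesis using low[OF that, of a] by linarith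
  qed
  \<comment> \<open>With this \<open>\<tau>\<close>, \<open>(1 + \<tau>) / (1 - \<tau>) = 1 + \<epsilon>\<close>.\<close>
  define \<tau> where "\<tau> = \<epsilon> / (2 + \<epsilon>)"
  have tau: "0 < \<tau>" "\<tau> < 1" using eps by (auto simp: \<tau>_def field_simps)
  define d where "d = \<tau> / (4 * D * (real n + 1))"
  have d: "d > 0" using tau D by (simp add: d_def)
  obtain F where F: "finite F"
    "\<And>a. (\<And>i. i < n \<Longrightarrow> \<bar>a i\<bar> \<le> 1) \<Longrightarrow> \<exists>b\<in>F. \<forall>i<n. \<bar>a i - b i\<bar> \<le> d"
    using finite_coefficient_net[OF d] by blast
  define U where "U = (\<Inter>b\<in>F. {f. \<bar>f b - N b\<bar> < \<tau> / (2 * D)})"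
  show ?thesis
  proof (rule that)
    show "open U" unfolding U_def
    proof (intro open_INT F ballI)
      fix b
      show "open {f. \<bar>f b - N b\<bar> < \<tau> / (2 * D)}"
        by (intro open_Collect_less continuous_intros)
          (rule continuous_on_subset[OF continuous_on_product_coordinates], simp)
    qed
    show "N \<in> U" using tau D by (simp add: U_def)
    fix M assume M: "dominated_seminorm n M" "M \<in> U"
    have close1: "\<bar>M a - N a\<bar> \<le> \<tau> / D" if a: "\<And>i. i < n \<Longrightarrow> \<bar>a i\<bar> \<le> 1" for a
    proof -
      obtain b where b: "b \<in> F" "\<And>i. i < n \<Longrightarrow> \<bar>a i - b i\<bar> \<le> d" using F(2) a by metis
      have "\<bar>M a - M b\<bar> \<le> real n * d" "\<bar>N a - N b\<bar> \<le> real n * d"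
        using dominated_seminorm_diff b M N by blast+
      moreover have "\<bar>M b - N b\<bar> < \<tau> / (2 * D)" using M b by (auto simp: U_def)
      moreover have "real n * d \<le> \<tau> / (4 * D)"
      proof -
        have "real n * d \<le> (real n + 1) * d" using d by simp
        also have "\<dots> = \<tau> / (4 * D)" using D by (simp add: d_def add_pos_nonneg)
        finally show ?thesis .
      qed
      ultimately show ?thesis by (simp add: field_simps)
    qed
    have close: "\<bar>M a - N a\<bar> \<le> \<tau> * N a" for a
    proof (cases "\<forall>i<n. a i = 0")
      case True
      then have "(\<Sum>i<n. \<bar>a i\<bar>) = 0" by simp
      then have "M a = 0" "N a = 0"
        using M(1) N unfolding dominated_seminorm_def by (metis order_antisym)+
      then show ?thesis by simp
    next
      case False
      define s where "s = Max ((\<lambda>i. \<bar>a i\<bar>) ` {..<n})"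
      have ne: "{..<n} \<noteq> {}" using False by auto
      have s_ge: "\<bar>a i\<bar> \<le> s" if "i < n" for i unfolding s_def by (rule Max_ge) (use that in auto)
      have "s \<in> (\<lambda>i. \<bar>a i\<bar>) ` {..<n}" unfolding s_def by (rule Max_in) (use ne in auto)
      then obtain j where j: "j < n" "s = \<bar>a j\<bar>" by auto
      obtain i where i: "i < n" "a i \<noteq> 0" using False by blast
      have s: "s > 0" using s_ge[OF i(1)] i(2) by linarith
      have sN: "s \<le> D * N a" using lowD[OF j(1), of a] j by simp
      have "\<bar>M (\<lambda>i. (1/s) * a i) - N (\<lambda>i. (1/s) * a i)\<bar> \<le> \<tau> / D"
        by (rule close1) (use s_ge s in \<open>simp add: abs_mult field_simps\<close>)
      moreover have "M (\<lambda>i. (1/s) * a i) = \<bar>1/s\<bar> * M a" "N (\<lambda>i. (1/s) * a i) = \<bar>1/s\<bar> * N a"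
        using M(1) N unfolding dominated_seminorm_def by blast+
      ultimately have "\<bar>\<bar>1/s\<bar> * M a - \<bar>1/s\<bar> * N a\<bar> \<le> \<tau> / D" by simp
      then have "\<bar>1/s\<bar> * \<bar>M a - N a\<bar> \<le> \<tau> / D"
        by (metis abs_abs abs_mult right_diff_distrib)
      then have "\<bar>M a - N a\<bar> \<le> \<tau> / D * s" using s by (simp add: field_simps)
      also have "\<dots> \<le> \<tau> / D * (D * N a)" using sN tau D by (intro mult_left_mono) auto
      finally show ?thesis using D by simp
    qed
    show "C_equivalent (1 + \<epsilon>) M N"
      unfolding C_equivalent_def
    proof (intro exI conjI allI)
      show "0 < 1 / (1 - \<tau>)" "0 < 1 + \<tau>" using tau by auto
      show "1 / (1 - \<tau>) * (1 + \<tau>) \<le> 1 + \<epsilon>" using eps by (simp add: \<tau>_def field_simps)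
      show "inverse (1 / (1 - \<tau>)) * N a \<le> M a" "M a \<le> (1 + \<tau>) * N a" for a
        using close[of a] by (auto simp: abs_le_iff algebra_simps)
    qed
  qed
qed

section \<open>Asymptotic structures arising from games\<close>

lemma tail_game_imp_play: "tail_game z P k ys \<Longrightarrow> \<exists>zs. P (ys @ zs)"
proof (induction k arbitrary: ys)
  case 0
  then show ?case by (intro exI[of _ "[]"]) simp
next
  case (Suc k)
  then obtain y where "tail_game z P k (ys @ [y])" by auto
  from Suc.IH[OF this] show ?case by auto
qed

context schauder
begin

definition list_controlled :: "'a list \<Rightarrow> bool" where
  "list_controlled ys \<longleftrightarrow> coefs_controlled ((1 + 2 * basis_const) ^ length ys) (length ys) ((!) ys)"

text \<open>
  The answer to \<open>m\<close> may be taken from a much smaller tail, separated in the sense of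
  \<open>tail_separation\<close> from the vectors played before; so a play may be assumed uniformly independent.
\<close>

lemma tail_game_controlled:
  assumes "tail_game z P k ys" "\<And>ys y. P ys \<Longrightarrow> y \<in> set ys \<Longrightarrow> norm y = 1" "list_controlled ys"
  shows "tail_game z (\<lambda>ys. P ys \<and> list_controlled ys) k ys"
  using assms(1,3)
proof (induction k arbitrary: ys)
  case (Suc k)
  obtain m0 where m0: "\<And>m a v. m0 \<le> m \<Longrightarrow> v \<in> tail m \<Longrightarrow>
    coeff_norm (length ys) ((!) ys) a \<le> 2 * basis_const * norm ((\<Sum>i<length ys. a i *\<^sub>R ys ! i) + v)"
    using tail_separation Suc.prems(2) unfolding list_controlled_def by blast
  show ?case
  proof (clarsimp)
    fix m
    obtain y where y: "y \<in> span (z ` {max m m0..})" "tail_game z P k (ys @ [y])"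
      using Suc.prems(1) by auto
    have nrm: "norm y = 1" using tail_game_imp_play[OF y(2)] assms(2) by fastforce
    have ym: "y \<in> span (z ` {m..})"
      by (rule span_tail_antimono[OF _ y(1)]) simp
    have nth: "(ys @ [y]) ! i = ys ! i" if "i < length ys" for i using that by (simp add: nth_append)
    have "coefs_controlled ((1 + 2 * basis_const) ^ Suc (length ys)) (Suc (length ys)) ((!) (ys @ [y]))"
    proof (rule coefs_controlled_Suc)
      show "coefs_controlled ((1 + 2 * basis_const) ^ length ys) (length ys) ((!) (ys @ [y]))"
        using Suc.prems(2) unfolding list_controlled_def coefs_controlled_def coeff_norm_def
        by (simp add: nth)
      show "0 \<le> 2 * basis_const" using basis_const_ge_1 by simp
      show "norm ((ys @ [y]) ! length ys) = 1" using nrm by simp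
      show "coeff_norm (length ys) ((!) (ys @ [y])) a
          \<le> 2 * basis_const * coeff_norm (Suc (length ys)) ((!) (ys @ [y])) a" for a
      proof -
        have "y \<in> tail (max m m0)" using y(1) closure_subset by blast
        then have "a (length ys) *\<^sub>R y \<in> tail (max m m0)"
          using subspace_tail subspace_scale by blast
        from m0[OF _ this, of a] show ?thesis by (simp add: coeff_norm_def nth)
      qed
    qed
    then have "list_controlled (ys @ [y])" by (simp add: list_controlled_def)
    from Suc.IH[OF y(2) this] ym
    show "\<exists>y\<in>span (z ` {m..}). tail_game z (\<lambda>ys. P ys \<and> list_controlled ys) k (ys @ [y])"
      by blast
  qed
qed simp

text \<open>
  The passage from the game to the asymptotic structure: any outcome \<open>P\<close> that can be enforced against all choices of tails is
  approximated by a member \<open>N\<close> of the asymptotic structure, namely by a cluster point of the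
  coefficient norms. The last conclusion transfers to \<open>N\<close> every closed condition on a single
  coefficient vector that \<open>P\<close> implies.
\<close>

lemma asymptotic_structure_of_game:
  assumes g: "tail_game z P n []" and nrm: "\<And>ys y. P ys \<Longrightarrow> y \<in> set ys \<Longrightarrow> norm y = 1"
  obtains N where "N \<in> asymptotic_structure z n"
    "\<And>a T. closed T \<Longrightarrow> (\<And>ys. P ys \<Longrightarrow> length ys = n \<Longrightarrow> coeff_norm n ((!) ys) a \<in> T) \<Longrightarrow> N a \<in> T"
proof -
  define f where "f ys = coeff_norm n ((!) ys)" for ys :: "'a list"
  define C where "C = (1 + 2 * basis_const) ^ n"
  define Q where "Q ys \<longleftrightarrow> P ys \<and> length ys = n \<and> list_controlled ys" for ys
  have "list_controlled []" by (simp add: list_controlled_def coefs_controlled_def)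
  from tail_game_length[OF tail_game_controlled[OF g nrm this]]
  have g': "tail_game z Q n []" by (rule tail_game_mono) (auto simp: Q_def)
  have nrmQ: "norm (ys ! i) = 1" if "Q ys" "i < n" for ys i
    using that nrm by (auto simp: Q_def)
  have dom: "dominated_seminorm n (f ys)" if "Q ys" for ys
    unfolding f_def using nrmQ[OF that] by (rule dominated_seminorm_coeff_norm)
  define S where "S = {h :: (nat \<Rightarrow> real) \<Rightarrow> real. \<forall>a. h a \<in> {0..(\<Sum>i<n. \<bar>a i\<bar>)}}"
  obtain N where N: "N \<in> S" "\<And>U. open U \<Longrightarrow> N \<in> U \<Longrightarrow> tail_game z (\<lambda>ys. Q ys \<and> f ys \<in> U) n []"
  proof (rule tail_game_cluster_point[OF g'])
    show "compact S" unfolding S_def by (rule compact_box)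
    show "f ys \<in> S" if "Q ys" for ys using dominated_seminormD(1,2)[OF dom[OF that]] by (simp add: S_def)
  qed blast
  note cont = continuous_on_subset[OF continuous_on_product_coordinates subset_UNIV]
  have limit: "R N" if "closed {h. R h}" "\<And>ys. Q ys \<Longrightarrow> R (f ys)" for R
    using tail_game_cluster_point_closed[OF N(2) that(1)] that(2) by blast
  have domN: "dominated_seminorm n N"
    unfolding dominated_seminorm_def
  proof (intro conjI allI)
    show "0 \<le> N a" "N a \<le> (\<Sum>i<n. \<bar>a i\<bar>)" for a using N(1) by (auto simp: S_def)
    show "N (\<lambda>i. c * a i) = \<bar>c\<bar> * N a" for c a
      by (rule limit) (intro closed_Collect_eq continuous_intros cont, simp add: dominated_seminormD[OF dom])
    show "N (\<lambda>i. a i + b i) \<le> N a + N b" for a b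
      by (rule limit) (intro closed_Collect_le continuous_intros cont, simp add: dominated_seminormD[OF dom])
  qed
  have low: "\<bar>a j\<bar> \<le> C * N a" if "j < n" for a j
  proof (rule limit)
    show "closed {h. \<bar>a j\<bar> \<le> C * h a}" by (intro closed_Collect_le continuous_intros cont)
    show "\<bar>a j\<bar> \<le> C * f ys a" if "Q ys" for ys
      using that \<open>j < n\<close> by (auto simp: Q_def list_controlled_def coefs_controlled_def C_def f_def)
  qed
  have unit: "N (\<lambda>i. if i = j then 1 else 0) = 1" if "j < n" for j
  proof (rule limit)
    show "closed {h. h (\<lambda>i. if i = j then 1 else 0) = (1::real)}"
      by (intro closed_Collect_eq continuous_intros cont)
    show "f ys (\<lambda>i. if i = j then 1 else 0) = 1" if "Q ys" for ys
      unfolding f_def using \<open>j < n\<close> nrmQ[OF that \<open>j < n\<close>] by (rule coeff_norm_unit)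
  qed
  have kernel: "N a = 0 \<longleftrightarrow> (\<forall>i<n. a i = 0)" for a
  proof
    show "\<forall>i<n. a i = 0" if "N a = 0" using low[of _ a] that by simp
    show "N a = 0" if "\<forall>i<n. a i = 0"
      using dominated_seminormD(1,2)[OF domN, of a] that by simp
  qed
  have "normalized_basic_norm n N"
    unfolding normalized_basic_norm_def using kernel unit dominated_seminormD[OF domN] by blast
  moreover have "tail_game z (\<lambda>ys. C_equivalent (1 + \<epsilon>) (coeff_norm n ((!) ys)) N) n []" if "\<epsilon> > 0" for \<epsilon>
  proof -
    obtain U where U: "open U" "N \<in> U"
      "\<And>M. dominated_seminorm n M \<Longrightarrow> M \<in> U \<Longrightarrow> C_equivalent (1 + \<epsilon>) M N"
      using pointwise_close_imp_C_equivalent[OF domN low \<open>\<epsilon> > 0\<close>] by blast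
    from N(2)[OF U(1,2)] show ?thesis
      by (rule tail_game_mono) (use U(3) dom in \<open>auto simp: f_def\<close>)
  qed
  ultimately have "N \<in> asymptotic_structure z n" by (simp add: asymptotic_structure_def)
  moreover have "N a \<in> T" if "closed T" and inT: "\<And>ys. P ys \<Longrightarrow> length ys = n \<Longrightarrow> coeff_norm n ((!) ys) a \<in> T" for a T
  proof (rule limit)
    show "closed {h. h a \<in> T}"
      using closed_vimage[OF that(1) continuous_on_product_coordinates, of a] by (simp add: vimage_def)
    show "f ys a \<in> T" if "Q ys" for ys using that by (simp add: Q_def f_def inT)
  qed
  ultimately show ?thesis using that by blast
qed

text \<open>
  It keeps the hypothesis of the main theorem from being vacuous, and so gives \<open>K > 0\<close>.
\<close>

lemma asymptotic_structure_nonempty: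
  obtains N where "N \<in> asymptotic_structure z n"
proof -
  have "tail_game z (\<lambda>ys. \<forall>y\<in>set ys. norm y = 1) k ys" if "\<forall>y\<in>set ys. norm y = 1" for k ys
    using that
  proof (induction k arbitrary: ys)
    case (Suc k)
    show ?case
    proof (clarsimp)
      fix m
      have "tail_game z (\<lambda>ys. \<forall>y\<in>set ys. norm y = 1) k (ys @ [(1 / norm (z m)) *\<^sub>R z m])"
        by (rule Suc.IH) (use Suc.prems z_nonzero in auto)
      moreover have "(1 / norm (z m)) *\<^sub>R z m \<in> span (z ` {m..})"
        by (simp add: span_base span_scale)
      ultimately show "\<exists>y\<in>span (z ` {m..}). tail_game z (\<lambda>ys. \<forall>y\<in>set ys. norm y = 1) k (ys @ [y])"
        by blast
    qed
  qed simp
  from asymptotic_structure_of_game[OF this[of "[]" n]] that show ?thesis by auto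
qed

end

text \<open>
  The game from the point of view of the player who chooses the tails: it has a strategy against normalized
  answers \<open>y\<close> that ends with \<open>\<phi> \<le> c\<close>, where \<open>s\<close> is the sum of the vectors played so far and \<open>k\<close> moves remain.
  The outcomes of interest depend on the sum only. The tolerance \<open>c\<close> is a parameter because
  perturbing a position costs a little of it.
\<close>

primrec forces :: "(nat \<Rightarrow> 'a::real_normed_vector) \<Rightarrow> ('a \<Rightarrow> real) \<Rightarrow> nat \<Rightarrow> 'a \<Rightarrow> real \<Rightarrow> bool" where
  "forces z \<phi> 0 s c \<longleftrightarrow> \<phi> s \<le> c"
| "forces z \<phi> (Suc k) s c \<longleftrightarrow>
     (\<exists>m. \<forall>y\<in>span (z ` {m..}). norm y = 1 \<longrightarrow> forces z \<phi> k (s + y) c)"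

lemma not_forces_imp_tail_game:
  "\<not> forces z \<phi> k (sum_list ys) c \<Longrightarrow> \<forall>y\<in>set ys. norm y = 1 \<Longrightarrow>
   tail_game z (\<lambda>ys. (\<forall>y\<in>set ys. norm y = 1) \<and> c < \<phi> (sum_list ys)) k ys"
proof (induction k arbitrary: ys)
  case (Suc k)
  show ?case
  proof (clarsimp)
    fix m
    obtain y where y: "y \<in> span (z ` {m..})" "norm y = 1" "\<not> forces z \<phi> k (sum_list (ys @ [y])) c"
      using Suc.prems(1) by auto
    show "\<exists>y\<in>span (z ` {m..}). tail_game z
         (\<lambda>ys. (\<forall>y\<in>set ys. norm y = 1) \<and> c < \<phi> (sum_list ys)) k (ys @ [y])"
      using Suc.IH[OF y(3)] Suc.prems(2) y by auto
  qed
qed simp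

lemma forces_lipschitz:
  assumes lip: "\<And>s t. \<phi> s \<le> \<phi> t + norm (s - t)"
  shows "forces z \<phi> k s c \<Longrightarrow> c + norm (s - t) \<le> c' \<Longrightarrow> forces z \<phi> k t c'"
proof (induction k arbitrary: s t)
  case 0
  then show ?case using lip[of t s] by (simp add: norm_minus_commute)
next
  case (Suc k)
  then obtain m where m: "\<And>y. y \<in> span (z ` {m..}) \<Longrightarrow> norm y = 1 \<Longrightarrow> forces z \<phi> k (s + y) c" by auto
  have "forces z \<phi> k (t + y) c'" if "y \<in> span (z ` {m..})" "norm y = 1" for y
    by (rule Suc.IH[OF m[OF that]]) (use Suc.prems in simp)
  then show ?case by auto
qed

context schauder
begin

lemma tail_approximation:
  assumes y: "y \<in> tail m" "norm y = 1" and d: "0 < d"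
  obtains u where "u \<in> span (z ` {m..})" "norm u = 1" "norm (y - u) < d"
proof -
  obtain w where w: "w \<in> span (z ` {m..})" "dist w y < min (d/2) (1/2)"
    using y(1) d unfolding closure_approachable by (metis half_gt_zero min_less_iff_conj zero_less_one)
  have d1: "norm (y - w) < d/2" "norm (y - w) < 1/2"
    using w(2) by (simp_all add: dist_norm norm_minus_commute)
  have n: "\<bar>1 - norm w\<bar> \<le> norm (y - w)" using norm_triangle_ineq3[of y w] y(2) by simp
  then have wpos: "norm w > 0" using d1 by linarith
  show ?thesis
  proof (rule that)
    show "(1 / norm w) *\<^sub>R w \<in> span (z ` {m..})" using w(1) by (rule span_scale)
    show "norm ((1 / norm w) *\<^sub>R w) = 1" using wpos by simp
    have "w - (1 / norm w) *\<^sub>R w = (1 - 1 / norm w) *\<^sub>R w" by (simp add: scaleR_diff_left)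
    then have "norm (w - (1 / norm w) *\<^sub>R w) = \<bar>1 - 1 / norm w\<bar> * norm w" by simp
    also have "\<dots> = \<bar>(1 - 1 / norm w) * norm w\<bar>" by (simp add: abs_mult)
    also have "(1 - 1 / norm w) * norm w = norm w - 1" using wpos by (simp add: field_simps)
    finally have "norm (w - (1 / norm w) *\<^sub>R w) \<le> norm (y - w)" using n by linarith
    then show "norm (y - (1 / norm w) *\<^sub>R w) < d"
      using norm_triangle_ineq[of "y - w" "w - (1 / norm w) *\<^sub>R w"] d1 by simp
  qed
qed

text \<open>
  A choice of tail that is good at one position is almost good at nearby positions, and also for
  vectors \<open>y\<close> in the closure of the span; finitely many positions are dense enough in a compact set, so one
  tail serves all of them. This makes the strategy independent of the exact position.
\<close>

lemma forces_uniform: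
  assumes lip: "\<And>s t. \<phi> s \<le> \<phi> t + norm (s - t)" and comp: "compact S" and \<epsilon>: "0 < \<epsilon>"
  obtains m0 where "\<And>m s y. m0 \<le> m \<Longrightarrow> s \<in> S \<Longrightarrow> forces z \<phi> (Suc k) s c \<Longrightarrow> y \<in> tail m \<Longrightarrow>
    norm y = 1 \<Longrightarrow> forces z \<phi> k (s + y) (c + \<epsilon>)"
proof -
  have "\<exists>m. \<forall>s\<in>ball t (\<epsilon>/4). \<forall>y\<in>span (z ` {m..}). forces z \<phi> (Suc k) s c \<longrightarrow> norm y = 1 \<longrightarrow>
      forces z \<phi> k (s + y) (c + \<epsilon>/2)" for t
  proof (cases "\<exists>s\<in>ball t (\<epsilon>/4). forces z \<phi> (Suc k) s c")
    case True
    then obtain s0 m where s0: "s0 \<in> ball t (\<epsilon>/4)"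
      and m: "\<forall>y\<in>span (z ` {m..}). norm y = 1 \<longrightarrow> forces z \<phi> k (s0 + y) c" by auto
    have "forces z \<phi> k (s + y) (c + \<epsilon>/2)"
      if "s \<in> ball t (\<epsilon>/4)" "y \<in> span (z ` {m..})" "norm y = 1" for s y
    proof (rule forces_lipschitz[OF lip])
      show "forces z \<phi> k (s0 + y) c" using m that by blast
      show "c + norm (s0 + y - (s + y)) \<le> c + \<epsilon> / 2"
        using s0 that(1) dist_triangle2[of s0 s t] by (simp add: dist_norm norm_minus_commute)
    qed
    then show ?thesis by blast
  qed blast
  then obtain M where M: "\<And>t s y. s \<in> ball t (\<epsilon>/4) \<Longrightarrow> y \<in> span (z ` {M t..}) \<Longrightarrow>
    forces z \<phi> (Suc k) s c \<Longrightarrow> norm y = 1 \<Longrightarrow> forces z \<phi> k (s + y) (c + \<epsilon>/2)" by metis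
  obtain F where F: "F \<subseteq> S" "finite F" "S \<subseteq> (\<Union>t\<in>F. ball t (\<epsilon>/4))"
    by (rule compactE_image[OF comp, of S "\<lambda>t. ball t (\<epsilon>/4)"]) (use \<epsilon> in auto)
  define m0 where "m0 = (\<Sum>t\<in>F. M t)"
  show ?thesis
  proof (rule that)
    fix m s y assume m: "m0 \<le> m" and s: "s \<in> S" and w: "forces z \<phi> (Suc k) s c"
      and y: "y \<in> tail m" "norm y = 1"
    obtain t where t: "t \<in> F" "s \<in> ball t (\<epsilon>/4)" using F(3) s by blast
    have Mt: "M t \<le> m" using member_le_sum[of t F M] t F(2) m by (simp add: m0_def)
    obtain u where u: "u \<in> span (z ` {m..})" "norm u = 1" "norm (y - u) < \<epsilon>/2"
      using tail_approximation[OF y, of "\<epsilon>/2"] \<epsilon> by auto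
    have "u \<in> span (z ` {M t..})" by (rule span_tail_antimono[OF Mt u(1)])
    then have "forces z \<phi> k (s + u) (c + \<epsilon>/2)" using M t(2) w u(2) by blast
    then show "forces z \<phi> k (s + y) (c + \<epsilon>)"
      by (rule forces_lipschitz[OF lip]) (use u(3) in \<open>simp add: norm_minus_commute\<close>)
  qed
qed

text \<open>
  Otherwise the opponent enforces sums whose norm is outside of \<open>{L..H}\<close> by at least \<open>c\<close>, and some
  member of the asymptotic structure has this property as well.
\<close>

lemma forces_of_asymptotic_structure:
  assumes LH: "\<And>N. N \<in> asymptotic_structure z n \<Longrightarrow> L \<le> N (\<lambda>i. 1) \<and> N (\<lambda>i. 1) \<le> H"
    and c: "0 < c"
  shows "forces z (\<lambda>s. max (L - norm s) (norm s - H)) n 0 c"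
proof (rule ccontr)
  define \<phi> where "\<phi> s = max (L - norm s) (norm s - H)" for s :: 'a
  assume "\<not> forces z (\<lambda>s. max (L - norm s) (norm s - H)) n 0 c"
  then have "\<not> forces z \<phi> n (sum_list []) c" by (simp add: \<phi>_def[abs_def])
  from not_forces_imp_tail_game[OF this]
  have g: "tail_game z (\<lambda>ys. (\<forall>y\<in>set ys. norm y = 1) \<and> c < \<phi> (sum_list ys)) n []" by simp
  define T where "T = {r::real. c \<le> max (L - r) (r - H)}"
  have cl: "closed T" unfolding T_def by (intro closed_Collect_le continuous_intros)
  obtain N where N: "N \<in> asymptotic_structure z n" "N (\<lambda>i. 1) \<in> T"
  proof (rule asymptotic_structure_of_game[OF g])
    show "norm y = 1" if "(\<forall>y\<in>set ys. norm y = 1) \<and> c < \<phi> (sum_list ys)" "y \<in> set ys" for ys y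
      using that by blast
    fix N assume N: "N \<in> asymptotic_structure z n"
      "\<And>a T. closed T \<Longrightarrow> (\<And>ys. (\<forall>y\<in>set ys. norm y = 1) \<and> c < \<phi> (sum_list ys) \<Longrightarrow> length ys = n \<Longrightarrow>
        coeff_norm n ((!) ys) a \<in> T) \<Longrightarrow> N a \<in> T"
    have "N (\<lambda>i. 1) \<in> T"
    proof (rule N(2)[OF cl])
      fix ys :: "'a list" assume ys: "(\<forall>y\<in>set ys. norm y = 1) \<and> c < \<phi> (sum_list ys)" "length ys = n"
      have "(\<Sum>i<n. ys ! i) = sum_list ys" using ys(2) by (simp add: sum_list_sum_nth atLeast0LessThan)
      then show "coeff_norm n ((!) ys) (\<lambda>i. 1) \<in> T" using ys by (simp add: coeff_norm_def T_def \<phi>_def)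
    qed
    with N(1) that show thesis by blast
  qed
  then show False using LH[OF N(1)] c by (auto simp: T_def)
qed

end

section \<open>A sequence in the subspace with \<open>\<ell>\<^sub>p\<close> block sums\<close>

lemma span_image_mono: "A \<subseteq> B \<Longrightarrow> v \<in> span (x ` A) \<Longrightarrow> v \<in> span (x ` B)"
  by (rule subsetD[OF span_mono[OF image_mono]])

context schauder
begin

lemma separated_imp_controlled:
  assumes nrm: "\<And>i. i < q \<Longrightarrow> norm (x i) = 1" and t: "\<And>i. i < q \<Longrightarrow> x i \<in> tail (m i)"
    and sep: "\<And>i a v. i < q \<Longrightarrow> v \<in> tail (m i) \<Longrightarrow>
       coeff_norm i x a \<le> 2 * basis_const * norm ((\<Sum>j<i. a j *\<^sub>R x j) + v)"
  shows "coefs_controlled ((1 + 2 * basis_const) ^ q) q x"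
  using assms
proof (induction q)
  case 0
  then show ?case by (simp add: coefs_controlled_def)
next
  case (Suc q)
  show ?case
  proof (rule coefs_controlled_Suc)
    show "coefs_controlled ((1 + 2 * basis_const) ^ q) q x" by (rule Suc.IH) (use Suc.prems in auto)
    show "0 \<le> 2 * basis_const" using basis_const_ge_1 by simp
    show "norm (x q) = 1" using Suc.prems by simp
    fix a
    have "a q *\<^sub>R x q \<in> tail (m q)" using Suc.prems(2) subspace_tail subspace_scale by blast
    from Suc.prems(3)[OF _ this, of a] show "coeff_norm q x a \<le> 2 * basis_const * coeff_norm (Suc q) x a"
      by (simp add: coeff_norm_def)
  qed
qed

text \<open>
  At stage \<open>q\<close> all positions reachable from the previous vectors lie in finitely many compact sets,
  so by \<open>forces_uniform\<close> a single tail follows the strategies of all the games of length \<open>n \<le> q\<close>, and the next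
  vector is taken from it. A normalized block then counts as one legal answer, and each
  block costs \<open>\<epsilon> n\<close>. The tails also separate each vector from the previous ones, which makes the sequence
  basic although its members are only in the closures of the tails.
\<close>

lemma forces_on_blocks:
  fixes \<phi> :: "nat \<Rightarrow> 'a \<Rightarrow> real"
  assumes X: "subspace X" "infinite_dimensional X"
    and lip: "\<And>n s t. \<phi> n s \<le> \<phi> n t + norm (s - t)"
    and start: "\<And>n. 1 \<le> n \<Longrightarrow> forces z (\<phi> n) n 0 (\<epsilon> n)" and \<epsilon>: "\<And>n. 0 < \<epsilon> n"
  obtains x where "range x \<subseteq> X" "\<And>i. norm (x i) = 1" "initial_bounded (2 * basis_const) x"
    "\<And>n y. 1 \<le> n \<Longrightarrow> normalized_block_basis x n n y \<Longrightarrow> \<phi> n (\<Sum>i<n. y i) \<le> (real n + 1) * \<epsilon> n"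
proof -
  \<comment> \<open>\<open>R q\<close> controls the coefficients of the first \<open>q\<close> vectors, by \<open>separated_imp_controlled\<close>; a sum of at most \<open>n\<close>
    normalized blocks of them therefore has coefficients bounded by \<open>R q * n\<close>.\<close>
  define R where "R q = (1 + 2 * basis_const) ^ q" for q :: nat
  \<comment> \<open>\<open>f i\<close> is the pair of the \<open>i\<close>-th vector and the index of its tail; \<open>sep\<close> and \<open>uni\<close> are the demands on
    the tail index \<open>m\<close> at stage \<open>q\<close>.\<close>
  define comb :: "(nat \<Rightarrow> 'a \<times> nat) \<Rightarrow> nat \<Rightarrow> (nat \<Rightarrow> real) \<Rightarrow> 'a" where
    "comb f q a = (\<Sum>i<q. a i *\<^sub>R fst (f i))" for f q a
  define sep where "sep f q m \<longleftrightarrow> (\<forall>a. \<forall>v\<in>tail m. norm (comb f q a) \<le> 2 * basis_const * norm (comb f q a + v))"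
    for f q m
  define uni where "uni f q m n k j \<longleftrightarrow> (\<forall>a. (\<forall>i. \<bar>a i\<bar> \<le> R q * real n) \<longrightarrow> (\<forall>y\<in>tail m. norm y = 1 \<longrightarrow>
      forces z (\<phi> n) (Suc k) (comb f q a) ((real j + 1) * \<epsilon> n) \<longrightarrow>
      forces z (\<phi> n) k (comb f q a + y) ((real j + 2) * \<epsilon> n)))" for f q m n k j
  define P where "P f q r \<longleftrightarrow> (\<forall>i<q. snd (f i) \<le> snd r) \<and> fst r \<in> X \<and> fst r \<in> tail (snd r) \<and>
      norm (fst r) = 1 \<and> sep f q (snd r) \<and> (\<forall>n\<in>{..q}. \<forall>k\<in>{..<n}. \<forall>j\<in>{..n}. uni f q (snd r) n k j)"
    for f q r
  have "\<exists>f. \<forall>q. P f q (f q)"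
  proof (rule dependent_wellorder_choice)
    fix r q and f g :: "nat \<Rightarrow> 'a \<times> nat" assume eq: "\<And>i. i < q \<Longrightarrow> f i = g i"
    have "comb f q = comb g q" unfolding comb_def using eq by (intro ext sum.cong) auto
    then show "P f q r = P g q r" unfolding P_def sep_def uni_def using eq by simp
  next
    fix q and f :: "nat \<Rightarrow> 'a \<times> nat" assume prev: "\<And>i. i < q \<Longrightarrow> P f i (f i)"
    define x where "x i = fst (f i)" for i
    have contr: "coefs_controlled (R q) q x" unfolding R_def
      by (rule separated_imp_controlled[where m="snd \<circ> f"])
        (use prev in \<open>auto simp: P_def sep_def comb_def x_def coeff_norm_def\<close>)
    have ev_sep: "\<forall>\<^sub>F m in sequentially. sep f q m"
    proof -
      obtain m0 where "\<And>m a v. m0 \<le> m \<Longrightarrow> v \<in> tail m \<Longrightarrow>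
          coeff_norm q x a \<le> 2 * basis_const * norm ((\<Sum>i<q. a i *\<^sub>R x i) + v)"
        by (rule tail_separation[OF contr]) blast
      then show ?thesis
        unfolding eventually_sequentially sep_def comb_def coeff_norm_def x_def by blast
    qed
    have ev_uni: "\<forall>\<^sub>F m in sequentially. uni f q m n k j" for n k j
    proof -
      define S where "S = comb f q ` {a. \<forall>i. a i \<in> {- (R q * real n)..R q * real n}}"
      have "continuous_on UNIV (comb f q)" unfolding comb_def by (intro continuous_intros)
          (rule continuous_on_product_coordinates)
      then have "compact S" unfolding S_def
        by (intro compact_continuous_image compact_box) (rule continuous_on_subset, auto)
      then obtain m0 where m0: "\<And>m s y. m0 \<le> m \<Longrightarrow> s \<in> S \<Longrightarrow>
          forces z (\<phi> n) (Suc k) s ((real j + 1) * \<epsilon> n) \<Longrightarrow> y \<in> tail m \<Longrightarrow> norm y = 1 \<Longrightarrow>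
          forces z (\<phi> n) k (s + y) ((real j + 1) * \<epsilon> n + \<epsilon> n)"
        using forces_uniform[OF lip _ \<epsilon>] by blast
      have "uni f q m n k j" if "m0 \<le> m" for m
        unfolding uni_def
      proof (intro allI impI ballI)
        fix a y assume a: "\<forall>i. \<bar>a i\<bar> \<le> R q * real n" and y: "y \<in> tail m" "norm y = 1"
          and fo: "forces z (\<phi> n) (Suc k) (comb f q a) ((real j + 1) * \<epsilon> n)"
        have "comb f q a \<in> S" unfolding S_def using a by (auto simp: abs_le_iff minus_le_iff)
        from m0[OF that this fo y] show "forces z (\<phi> n) k (comb f q a + y) ((real j + 2) * \<epsilon> n)"
          by (simp add: algebra_simps)
      qed
      then show ?thesis unfolding eventually_sequentially by blast
    qed
    have ev_mono: "\<forall>\<^sub>F m in sequentially. \<forall>i\<in>{..<q}. snd (f i) \<le> m"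
      by (intro eventually_ball_finite ballI eventually_ge_at_top) auto
    have "\<forall>\<^sub>F m in sequentially. \<forall>n\<in>{..q}. \<forall>k\<in>{..<n}. \<forall>j\<in>{..n}. uni f q m n k j"
      by (intro eventually_ball_finite ballI ev_uni) auto
    with ev_sep ev_mono have "\<forall>\<^sub>F m in sequentially. sep f q m \<and> (\<forall>i\<in>{..<q}. snd (f i) \<le> m) \<and>
        (\<forall>n\<in>{..q}. \<forall>k\<in>{..<n}. \<forall>j\<in>{..n}. uni f q m n k j)"
      by eventually_elim blast
    then obtain m where m: "sep f q m" "\<forall>i\<in>{..<q}. snd (f i) \<le> m"
      "\<forall>n\<in>{..q}. \<forall>k\<in>{..<n}. \<forall>j\<in>{..n}. uni f q m n k j"
      unfolding eventually_sequentially by blast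
    obtain u where "u \<in> X" "u \<in> tail m" "norm u = 1" using unit_vector_in_tail[OF X] by blast
    then have "P f q (u, m)" using m by (simp add: P_def)
    then show "\<exists>r. P f q r" by blast
  qed
  then obtain f where f: "\<And>q. P f q (f q)" by blast
  define x where "x i = fst (f i)" for i
  define m where "m i = snd (f i)" for i
  have nrm: "norm (x i) = 1" for i unfolding x_def using f[of i, unfolded P_def] by (elim conjE)
  have xX: "x i \<in> X" for i unfolding x_def using f[of i, unfolded P_def] by (elim conjE)
  have xt: "x i \<in> tail (m i)" for i
    unfolding x_def m_def using f[of i, unfolded P_def] by (elim conjE)
  have f_sep: "sep f i (m i)" for i unfolding m_def using f[of i, unfolded P_def] by (elim conjE)
  have f_uni: "uni f q (m q) n k j" if "n \<le> q" "k < n" "j \<le> n" for q n k j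
  proof -
    have "\<forall>n\<in>{..q}. \<forall>k\<in>{..<n}. \<forall>j\<in>{..n}. uni f q (snd (f q)) n k j"
      using f[of q, unfolded P_def] by (elim conjE)
    then show ?thesis using that unfolding m_def by blast
  qed
  have m_less: "\<forall>i<q. m i \<le> m q" for q
    unfolding m_def using f[of q, unfolded P_def] by (elim conjE)
  have m_mono: "i \<le> q \<Longrightarrow> m i \<le> m q" for i q
    using m_less[of q] by (cases "i = q") auto
  have span_tail: "v \<in> tail (m q)" if "v \<in> span (x ` {q..})" for v q
  proof -
    have "x ` {q..} \<subseteq> tail (m q)" 
    proof (rule image_subsetI)
      fix i assume "i \<in> {q..}"
      then show "x i \<in> tail (m q)" using subsetD[OF tail_antimono[OF m_mono] xt] by simp
    qed
    from span_minimal[OF this subspace_tail] show ?thesis using that by blast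
  qed
  have sepx: "coeff_norm q x a \<le> 2 * basis_const * norm ((\<Sum>i<q. a i *\<^sub>R x i) + v)" if "v \<in> tail (m q)" for q a v
    using f_sep[of q] that unfolding sep_def comb_def x_def coeff_norm_def by blast
  show ?thesis
  proof (rule that[of x])
    show "range x \<subseteq> X" "norm (x i) = 1" for i using nrm xX by auto
    show "initial_bounded (2 * basis_const) x"
      unfolding initial_bounded_def
    proof (intro allI impI)
      fix a :: "nat \<Rightarrow> real" and q r :: nat assume qr: "q \<le> r"
      have "(\<Sum>i<r. a i *\<^sub>R x i) = (\<Sum>i<q. a i *\<^sub>R x i) + (\<Sum>i=q..<r. a i *\<^sub>R x i)"
        using sum.atLeastLessThan_concat[of 0 q r "\<lambda>i. a i *\<^sub>R x i"] qr by (simp add: atLeast0LessThan)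
      moreover have "(\<Sum>i=q..<r. a i *\<^sub>R x i) \<in> tail (m q)"
        by (intro span_tail span_sum span_scale span_base) auto
      ultimately show "coeff_norm q x a \<le> 2 * basis_const * coeff_norm r x a"
        using sepx[of "\<Sum>i=q..<r. a i *\<^sub>R x i" q a] by (simp add: coeff_norm_def)
    qed
    fix n y assume n: "1 \<le> n" and "normalized_block_basis x n n y"
    then obtain k where k0: "n \<le> k 0" and k: "\<And>i. i < n \<Longrightarrow> k i < k (Suc i)"
      "\<And>i. i < n \<Longrightarrow> y i \<in> span (x ` {k i..<k (Suc i)})" "\<And>i. i < n \<Longrightarrow> norm (y i) = 1"
      unfolding normalized_block_basis_def by blast
    have k_mono: "i \<le> n \<Longrightarrow> n \<le> k i" for i
    proof (induction i)
      case (Suc i)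
      then show ?case using k(1)[of i] by simp
    qed (use k0 in simp)
    have span_sum: "i \<le> n \<Longrightarrow> (\<Sum>j<i. y j) \<in> span (x ` {..<k i})" for i
    proof (induction i)
      case (Suc i)
      have "(\<Sum>j<i. y j) \<in> span (x ` {..<k (Suc i)})"
        by (rule span_image_mono[OF _ Suc.IH]) (use Suc.prems k(1)[of i] in auto)
      moreover have "y i \<in> span (x ` {..<k (Suc i)})"
        by (rule span_image_mono[OF _ k(2)]) (use Suc.prems in auto)
      ultimately show ?case by (simp add: span_add)
    qed (simp add: span_zero)
    have "i \<le> n \<Longrightarrow> forces z (\<phi> n) (n - i) (\<Sum>j<i. y j) ((real i + 1) * \<epsilon> n)" for i
    proof (induction i)
      case 0
      then show ?case using start n by simp
    next
      case (Suc i)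
      then have i: "i < n" by simp
      define s where "s = (\<Sum>j<i. y j)"
      obtain a :: "nat \<Rightarrow> real" and F where a: "\<And>l. l \<notin> F \<Longrightarrow> a l = 0" "F \<subseteq> {..<k i}"
        "s = (\<Sum>l<k i. a l *\<^sub>R x l)"
        using span_image_coefficients[OF span_sum[of i]] i unfolding s_def
        by (metis less_imp_le_nat)
      have ns: "norm s \<le> real n"
      proof -
        have "norm s \<le> (\<Sum>j<i. norm (y j))" unfolding s_def by (rule norm_sum)
        also have "\<dots> = real i" using k(3) i by simp
        finally show ?thesis using i by simp
      qed
      have contr: "coefs_controlled (R (k i)) (k i) x" unfolding R_def
        using separated_imp_controlled[of "k i" x m] nrm xt sepx by blast
      have a_le: "\<bar>a l\<bar> \<le> R (k i) * real n" for l
      proof (cases "l < k i")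
        case True
        then have "\<bar>a l\<bar> \<le> R (k i) * norm s" using contr a(3) by (auto simp: coefs_controlled_def coeff_norm_def)
        also have "\<dots> \<le> R (k i) * real n" using ns basis_const_ge_1 by (intro mult_left_mono) (auto simp: R_def)
        finally show ?thesis .
      next
        case False
        then have "a l = 0" using a(1,2) by blast
        then show ?thesis using basis_const_ge_1 by (simp add: R_def)
      qed
      have comb: "comb f (k i) a = s" by (simp add: comb_def a(3) x_def)
      have yt: "y i \<in> tail (m (k i))"
        by (rule span_tail[OF span_image_mono[OF _ k(2)[OF i]]]) auto
      have "uni f (k i) (m (k i)) n (n - Suc i) i"
        by (rule f_uni) (use k_mono[of i] i in auto)
      then have "forces z (\<phi> n) (Suc (n - Suc i)) s ((real i + 1) * \<epsilon> n) \<Longrightarrow>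
          forces z (\<phi> n) (n - Suc i) (s + y i) ((real i + 2) * \<epsilon> n)"
        unfolding uni_def using a_le yt k(3)[OF i] comb by blast
      moreover have "Suc (n - Suc i) = n - i" using i by simp
      ultimately show ?case using Suc.IH i by (simp add: s_def add.commute)
    qed
    from this[of n] show "\<phi> n (\<Sum>i<n. y i) \<le> (real n + 1) * \<epsilon> n" by simp
  qed
qed

end

text \<open>
  The sequence version of the hypothesis on the asymptotic structure: sums of \<open>n\<close> normalized blocks
  of the \<open>n\<close>-th tail have norm \<open>n powr (1 / p)\<close> up to the factor \<open>K\<close>.
\<close>

definition lp_sums :: "real \<Rightarrow> real \<Rightarrow> (nat \<Rightarrow> 'a::real_normed_vector) \<Rightarrow> bool" where
  "lp_sums p K x \<longleftrightarrow> (\<forall>n y. 1 \<le> n \<longrightarrow> normalized_block_basis x n n y \<longrightarrow>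
     inverse K * real n powr (1 / p) \<le> norm (\<Sum>i<n. y i) \<and> norm (\<Sum>i<n. y i) \<le> K * real n powr (1 / p))"

lemma (in schauder) lp_sums_sequence_in_subspace:
  fixes X :: "'a set"
  assumes hyp: "\<And>n N. 1 \<le> n \<Longrightarrow> N \<in> asymptotic_structure z n \<Longrightarrow>
           inverse K * real n powr (1 / p) \<le> N (\<lambda>i. 1) \<and> N (\<lambda>i. 1) \<le> K * real n powr (1 / p)"
    and X: "subspace X" "infinite_dimensional X"
  obtains x where "range x \<subseteq> X" "\<And>i. norm (x i) = 1" "initial_bounded (2 * basis_const) x" "lp_sums p (2 * K) x"
proof -
  have K: "0 < K"
  proof -
    obtain N where N: "N \<in> asymptotic_structure z 1" by (rule asymptotic_structure_nonempty)
    then have nb: "normalized_basic_norm 1 N" by (simp add: asymptotic_structure_def)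
    have "N (\<lambda>i. 1) \<noteq> 0" "0 \<le> N (\<lambda>i. 1)"
      using nb unfolding normalized_basic_norm_def by (metis less_one zero_neq_one, blast)
    then show ?thesis using hyp[OF _ N] by simp
  qed
  define L where "L n = inverse K * real n powr (1 / p)" for n :: nat
  define H where "H n = K * real n powr (1 / p)" for n :: nat
  define \<phi> where "\<phi> n s = max (L n - norm s) (norm s - H n)" for n and s :: 'a
  \<comment> \<open>The total loss \<open>(n + 1) * \<epsilon> n\<close> is \<open>L n / 2\<close>; the value at \<open>0\<close> only has to be positive.\<close>
  define \<epsilon> where "\<epsilon> n = (if n = 0 then 1 else L n / (2 * (real n + 1)))" for n
  have L: "0 < L n" if "1 \<le> n" for n using K that by (simp add: L_def)
  have LH: "L n \<le> H n" if "1 \<le> n" for n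
    using asymptotic_structure_nonempty[of n] hyp[OF that] by (metis L_def H_def order_trans)
  have eps: "0 < \<epsilon> n" for n using L[of n] by (auto simp: \<epsilon>_def intro!: divide_pos_pos)
  obtain x :: "nat \<Rightarrow> 'a" where x: "range x \<subseteq> X" "\<And>i. norm (x i) = 1"
    "initial_bounded (2 * basis_const) x"
    "\<And>n (y :: nat \<Rightarrow> 'a). 1 \<le> n \<Longrightarrow> normalized_block_basis x n n y \<Longrightarrow> \<phi> n (\<Sum>i<n. y i) \<le> (real n + 1) * \<epsilon> n"
  proof (rule forces_on_blocks[OF X, of \<phi> \<epsilon>])
    show "\<phi> n s \<le> \<phi> n t + norm (s - t)" for n s t
      using norm_triangle_ineq2[of s t] norm_triangle_ineq2[of t s]
      by (simp add: \<phi>_def norm_minus_commute max_def)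
    show "forces z (\<phi> n) n 0 (\<epsilon> n)" if "1 \<le> n" for n
      using forces_of_asymptotic_structure[of n "L n" "H n" "\<epsilon> n"] hyp[OF that] eps
      by (simp add: \<phi>_def[abs_def] L_def H_def)
    show "0 < \<epsilon> n" for n by (rule eps)
  qed blast
  have "lp_sums p (2 * K) x"
    unfolding lp_sums_def
  proof (intro allI impI)
    fix n y assume n: "1 \<le> n" and y: "normalized_block_basis x n n y"
    have "(real n + 1) * \<epsilon> n = L n / 2" using n by (simp add: \<epsilon>_def field_simps)
    with x(4)[OF n y] have "L n / 2 \<le> norm (\<Sum>i<n. y i)" "norm (\<Sum>i<n. y i) \<le> 2 * H n"
      using LH[OF n] L[OF n] by (simp_all add: \<phi>_def max_def split: if_splits)
    then show "inverse (2 * K) * real n powr (1 / p) \<le> norm (\<Sum>i<n. y i) \<and>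
        norm (\<Sum>i<n. y i) \<le> 2 * K * real n powr (1 / p)"
      by (simp add: L_def H_def)
  qed
  with x that show ?thesis by blast
qed

section \<open>Pieces of almost equal norm\<close>

text \<open>
  The vectors of the list have consecutive supports in \<open>{s..<t}\<close>, possibly with gaps. Lists are
  used because pieces of several vectors are going to be concatenated.
\<close>

primrec successive :: "(nat \<Rightarrow> 'a::real_vector) \<Rightarrow> nat \<Rightarrow> 'a list \<Rightarrow> nat \<Rightarrow> bool" where
  "successive x s [] t \<longleftrightarrow> s \<le> t"
| "successive x s (g # gs) t \<longleftrightarrow> (\<exists>u>s. g \<in> span (x ` {s..<u}) \<and> successive x u gs t)"

lemma successive_le: "successive x s gs t \<Longrightarrow> s \<le> t"
  by (induction gs arbitrary: s) (auto dest: less_imp_le_nat order_trans)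

lemma successive_mono: "successive x s gs t \<Longrightarrow> t \<le> t' \<Longrightarrow> successive x s gs t'"
  by (induction gs arbitrary: s) auto

lemma successive_extend_left:
  assumes "successive x s gs t" "r \<le> s"
  shows "successive x r gs t"
proof (cases gs)
  case (Cons g hs)
  then obtain u where u: "u > s" "g \<in> span (x ` {s..<u})" "successive x u hs t" using assms by auto
  have "g \<in> span (x ` {r..<u})" by (rule span_image_mono[OF _ u(2)]) (use assms in auto)
  then show ?thesis using Cons u assms by (auto intro!: exI[of _ u])
qed (use assms in auto)

lemma successive_append:
  "successive x s gs t \<Longrightarrow> successive x t hs u \<Longrightarrow> successive x s (gs @ hs) u"
proof (induction gs arbitrary: s)
  case Nil
  then show ?case using successive_extend_left by auto
qed auto

lemma successive_take: "successive x s gs t \<Longrightarrow> successive x s (take i gs) t"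
proof (induction gs arbitrary: s i)
  case (Cons g gs)
  then obtain u where "u > s" "g \<in> span (x ` {s..<u})" "successive x u gs t" by auto
  then show ?case using Cons.IH[of u "i - 1"] successive_le[OF Cons.prems]
    by (cases i) auto
qed simp

lemma successive_breakpoints:
  "successive x s gs t \<Longrightarrow> \<exists>k. k 0 = s \<and>
     (\<forall>i<length gs. k i < k (Suc i) \<and> gs ! i \<in> span (x ` {k i..<k (Suc i)}))"
proof (induction gs arbitrary: s)
  case (Cons g gs)
  then obtain u where u: "u > s" "g \<in> span (x ` {s..<u})" "successive x u gs t" by auto
  from Cons.IH[OF u(3)] obtain k where k: "k 0 = u"
    "\<forall>i<length gs. k i < k (Suc i) \<and> gs ! i \<in> span (x ` {k i..<k (Suc i)})" by blast
  have "case_nat s k i < case_nat s k (Suc i) \<and>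
      (g # gs) ! i \<in> span (x ` {case_nat s k i..<case_nat s k (Suc i)})" if "i < length (g # gs)" for i
    using that u k by (cases i) auto
  then show ?case by (intro exI[of _ "case_nat s k"]) simp
qed auto

lemma successive_imp_block_basis:
  assumes s: "successive x s gs t" and len: "m \<le> s" and nz: "\<And>g. g \<in> set gs \<Longrightarrow> g \<noteq> 0"
  shows "normalized_block_basis x m (length gs) (\<lambda>i. (1 / norm (gs ! i)) *\<^sub>R gs ! i)"
proof -
  obtain k where k: "k 0 = s"
    "\<forall>i<length gs. k i < k (Suc i) \<and> gs ! i \<in> span (x ` {k i..<k (Suc i)})"
    using successive_breakpoints[OF s] by blast
  have "norm ((1 / norm (gs ! i)) *\<^sub>R gs ! i) = 1" if "i < length gs" for i
    using nz[OF nth_mem[OF that]] by simp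
  then show ?thesis unfolding normalized_block_basis_def using k len
    by (intro exI[of _ k]) (auto simp: span_scale)
qed

text \<open>
  Normalizing the pieces changes their sum by at most \<open>length gs * h\<close>, apart from the common factor \<open>d\<close>.
\<close>

lemma lp_sums_almost_equal_norms:
  assumes fl: "lp_sums p K x" and K: "1 \<le> K" and p: "1 \<le> p"
    and s: "successive x s gs t" "length gs \<le> s"
    and d: "0 < d" and nrm: "\<And>g. g \<in> set gs \<Longrightarrow> d \<le> norm g \<and> norm g \<le> d + h"
    and h: "real (length gs) * h \<le> d / (2 * K)"
  shows "d * real (length gs) powr (1 / p) / (2 * K) \<le> norm (sum_list gs)"
    and "norm (sum_list gs) \<le> 2 * K * d * real (length gs) powr (1 / p)"
proof -
  define n where "n = length gs"
  define R where "R = real n powr (1 / p)"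
  have "d * R / (2 * K) \<le> norm (sum_list gs) \<and> norm (sum_list gs) \<le> 2 * K * d * R"
  proof (cases "n = 0")
    case True
    then show ?thesis using p by (simp add: n_def R_def)
  next
    case False
    define y where "y i = (1 / norm (gs ! i)) *\<^sub>R gs ! i" for i
    define Y where "Y = (\<Sum>i<n. y i)"
    have R1: "1 \<le> R" using False p by (simp add: R_def ge_one_powr_ge_zero)
    have "normalized_block_basis x n n y" unfolding y_def n_def
      by (rule successive_imp_block_basis[OF s]) (use nrm d in fastforce)
    then have Y: "inverse K * R \<le> norm Y" "norm Y \<le> K * R"
      using fl False unfolding lp_sums_def R_def Y_def by (auto simp: Suc_le_eq)
    have "sum_list gs - d *\<^sub>R Y = (\<Sum>i<n. gs ! i - d *\<^sub>R y i)"
      by (simp add: n_def Y_def sum_list_sum_nth atLeast0LessThan sum_subtractf scaleR_sum_right)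
    also have "norm \<dots> \<le> (\<Sum>i<n. h)"
    proof (rule order_trans[OF norm_sum], rule sum_mono)
      fix i assume "i \<in> {..<n}"
      then have gi: "d \<le> norm (gs ! i)" "norm (gs ! i) \<le> d + h" using nrm by (auto simp: n_def)
      have "gs ! i - d *\<^sub>R y i = (1 - d / norm (gs ! i)) *\<^sub>R gs ! i" by (simp add: y_def scaleR_diff_left)
      then have "norm (gs ! i - d *\<^sub>R y i) = (1 - d / norm (gs ! i)) * norm (gs ! i)"
        using gi d divide_le_eq_1[of d "norm (gs ! i)"] by simp
      also have "\<dots> = norm (gs ! i) - d" using gi d by (cases "gs ! i = 0") (auto simp: left_diff_distrib)
      finally show "norm (gs ! i - d *\<^sub>R y i) \<le> h" using gi by simp
    qed
    also have "\<dots> \<le> d / (2 * K)" using h by (simp add: n_def)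
    also have "\<dots> \<le> d / (2 * K) * R"
      using mult_left_mono[OF R1, of "d / (2 * K)"] d K by simp
    finally have diff: "norm (sum_list gs - d *\<^sub>R Y) \<le> d * R / (2 * K)" by simp
    have 1: "norm (d *\<^sub>R Y) \<le> norm (sum_list gs) + norm (sum_list gs - d *\<^sub>R Y)"
      using norm_triangle_ineq4[of "sum_list gs" "sum_list gs - d *\<^sub>R Y"] by simp
    have 2: "norm (sum_list gs) \<le> norm (d *\<^sub>R Y) + norm (sum_list gs - d *\<^sub>R Y)"
      using norm_triangle_ineq[of "d *\<^sub>R Y" "sum_list gs - d *\<^sub>R Y"] by simp
    have "d * (inverse K * R) \<le> norm (d *\<^sub>R Y)" "norm (d *\<^sub>R Y) \<le> d * (K * R)"
      using Y d by (simp_all add: mult_left_mono)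
    moreover have "d * (inverse K * R) = 2 * (d * R / (2 * K))" using K by (simp add: field_simps)
    moreover have "d * R / (2 * K) \<le> d * (K * R)"
    proof -
      have "d * R / (2 * K) \<le> d * R / 1" using K d R1 by (intro divide_left_mono) auto
      also have "\<dots> \<le> d * R * K" using K d R1 by simp
      finally show ?thesis by (simp add: mult_ac)
    qed
    ultimately show ?thesis using 1 2 diff by (simp add: mult_ac)
  qed
  then show "d * real (length gs) powr (1 / p) / (2 * K) \<le> norm (sum_list gs)"
    and "norm (sum_list gs) \<le> 2 * K * d * real (length gs) powr (1 / p)"
    by (simp_all add: R_def n_def)
qed

text \<open>
  Terms are collected until the norm of their sum reaches \<open>d\<close>; as single terms are small, it does not
  overshoot by more than \<open>h\<close>. The last conclusion says that the first \<open>i\<close> pieces add up to an initial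
  segment of the vector, which later bounds the number of pieces.
\<close>

lemma greedy_splitting:
  fixes x :: "nat \<Rightarrow> 'a::real_normed_vector"
  assumes "s \<le> t" and d: "0 < d" and c: "\<And>j. s \<le> j \<Longrightarrow> j < t \<Longrightarrow> norm (c j *\<^sub>R x j) \<le> h"
  obtains gs where "successive x s gs t" "\<And>g. g \<in> set gs \<Longrightarrow> d \<le> norm g \<and> norm g \<le> d + h"
    "norm ((\<Sum>j=s..<t. c j *\<^sub>R x j) - sum_list gs) < d"
    "\<And>i. \<exists>u. s \<le> u \<and> u \<le> t \<and> sum_list (take i gs) = (\<Sum>j=s..<u. c j *\<^sub>R x j)"
proof -
  define G where "G a b = (\<Sum>j=a..<b. c j *\<^sub>R x j)" for a b
  have G_concat: "a \<le> b \<Longrightarrow> b \<le> r \<Longrightarrow> G a b + G b r = G a r" for a b r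
    unfolding G_def by (rule sum.atLeastLessThan_concat)
  have "\<exists>gs u. successive x s gs u \<and> s \<le> u \<and> u \<le> t \<and> (\<forall>g\<in>set gs. d \<le> norm g \<and> norm g \<le> d + h) \<and>
      sum_list gs = G s u \<and> norm (G u t) < d \<and>
      (\<forall>i. \<exists>u. s \<le> u \<and> u \<le> t \<and> sum_list (take i gs) = G s u)"
    using \<open>s \<le> t\<close> c
  proof (induction t rule: dec_induct)
    case base
    show ?case using d by (intro exI[of _ "[]"] exI[of _ s]) (auto simp: G_def)
  next
    case (step t)
    then obtain gs u where gs: "successive x s gs u" "s \<le> u" "u \<le> t"
      "\<forall>g\<in>set gs. d \<le> norm g \<and> norm g \<le> d + h" "sum_list gs = G s u" "norm (G u t) < d"
      "\<And>i. \<exists>u. s \<le> u \<and> u \<le> t \<and> sum_list (take i gs) = G s u"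
      by (metis less_SucI)
    have pre: "\<exists>u. s \<le> u \<and> u \<le> Suc t \<and> sum_list (take i gs) = G s u" for i
      using gs(7)[of i] le_SucI by blast
    have GS: "G u (Suc t) = G u t + c t *\<^sub>R x t" using gs(3) by (simp add: G_def)
    show ?case
    proof (cases "norm (G u (Suc t)) < d")
      case True
      then show ?thesis using gs pre by (intro exI[of _ gs] exI[of _ u]) auto
    next
      case False
      have "norm (G u (Suc t)) \<le> norm (G u t) + norm (c t *\<^sub>R x t)" unfolding GS by (rule norm_triangle_ineq)
      also have "\<dots> \<le> d + h" using gs(6) step.prems[of t] step.hyps by fastforce
      finally have g: "d \<le> norm (G u (Suc t)) \<and> norm (G u (Suc t)) \<le> d + h" using False by simp
      have "G u (Suc t) \<in> span (x ` {u..<Suc t})" unfolding G_def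
        by (intro span_sum span_scale span_base imageI)
      then have succ: "successive x s (gs @ [G u (Suc t)]) (Suc t)"
        using gs(3) by (intro successive_append[OF gs(1)]) (auto intro!: exI[of _ "Suc t"])
      have tot: "sum_list (gs @ [G u (Suc t)]) = G s (Suc t)"
        using gs G_concat[of s u "Suc t"] by simp
      have "\<exists>v. s \<le> v \<and> v \<le> Suc t \<and> sum_list (take i (gs @ [G u (Suc t)])) = G s v" for i
      proof (cases "i \<le> length gs")
        case True
        then show ?thesis using pre[of i] by simp
      next
        case False
        then have "take i (gs @ [G u (Suc t)]) = gs @ [G u (Suc t)]" by simp
        then show ?thesis using tot step.hyps by (intro exI[of _ "Suc t"]) simp
      qed
      then show ?thesis using succ tot g gs(4) step.hyps d
        by (intro exI[of _ "gs @ [G u (Suc t)]"] exI[of _ "Suc t"]) (auto simp: G_def)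
    qed
  qed
  then obtain gs u where gs: "successive x s gs u" "s \<le> u" "u \<le> t"
      "\<forall>g\<in>set gs. d \<le> norm g \<and> norm g \<le> d + h" "sum_list gs = G s u" "norm (G u t) < d"
      "\<And>i. \<exists>u. s \<le> u \<and> u \<le> t \<and> sum_list (take i gs) = G s u" by blast
  show ?thesis
  proof (rule that)
    show "successive x s gs t" using gs successive_mono by blast
    show "d \<le> norm g \<and> norm g \<le> d + h" if "g \<in> set gs" for g using gs(4) that by blast
    have "G s t - sum_list gs = G u t" using G_concat[OF gs(2,3)] gs(5) by (simp add: algebra_simps)
    then show "norm ((\<Sum>j=s..<t. c j *\<^sub>R x j) - sum_list gs) < d"
      using gs(6) by (simp add: G_def)
    show "\<exists>u. s \<le> u \<and> u \<le> t \<and> sum_list (take i gs) = (\<Sum>j=s..<u. c j *\<^sub>R x j)" for i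
      using gs(7)[of i] by (simp add: G_def)
  qed
qed

lemma initial_bounded_segment:
  assumes ib: "initial_bounded B x" and u: "s \<le> u" "u \<le> t"
  shows "norm (\<Sum>j=s..<u. c j *\<^sub>R x j) \<le> B * norm (\<Sum>j=s..<t. c j *\<^sub>R x j)"
proof -
  define c' where "c' j = (if s \<le> j then c j else 0)" for j
  have eq: "(\<Sum>j<r. c' j *\<^sub>R x j) = (\<Sum>j=s..<r. c j *\<^sub>R x j)" for r
  proof -
    have "(\<Sum>j<r. c' j *\<^sub>R x j) = (\<Sum>j=s..<r. c' j *\<^sub>R x j)"
      by (rule sum.mono_neutral_right) (auto simp: c'_def)
    also have "\<dots> = (\<Sum>j=s..<r. c j *\<^sub>R x j)" by (rule sum.cong) (auto simp: c'_def)
    finally show ?thesis .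
  qed
  show ?thesis using ib u(2) unfolding initial_bounded_def coeff_norm_def
    by (metis eq)
qed

section \<open>Counting pieces\<close>

lemma powr_p_inverse: "0 \<le> x \<Longrightarrow> 1 \<le> (p::real) \<Longrightarrow> (x powr (1 / p)) powr p = x"
  by (simp add: powr_powr)

lemma powr_le_imp_le:
  fixes x y p :: real
  assumes "x powr p \<le> y powr p" "0 \<le> y" "0 < p"
  shows "x \<le> y"
  using powr_less_mono2[of p y x] assms by linarith

lemma successive_concat:
  assumes "\<And>l. l < n \<Longrightarrow> successive x (s l) (gs l) (s (Suc l))"
  shows "successive x (s 0) (concat (map gs [0..<n])) (s n)"
  using assms
proof (induction n)
  case (Suc n)
  have "successive x (s 0) (concat (map gs [0..<n])) (s n)" by (rule Suc.IH) (use Suc.prems in simp)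
  from successive_append[OF this Suc.prems[of n]] show ?case by simp
qed simp

lemma length_concat_upt: "length (concat (map gs [0..<n])) = (\<Sum>l<n. length (gs l))"
  by (induction n) simp_all

lemma sum_list_concat_upt:
  "sum_list (concat (map gs [0..<n])) = (\<Sum>l<n. sum_list (gs l) :: 'a::comm_monoid_add)"
  by (induction n) simp_all

text \<open>
  Here \<open>V l\<close> stands for the norm of a vector that splits into \<open>N l\<close> pieces of norm \<open>d\<close>, up to a
  remainder of norm at most \<open>d\<close>. Then \<open>V l powr p\<close> is comparable to \<open>d powr p * N l\<close>, unless both are of
  the order of the negligible \<open>d powr p\<close>. Summing over \<open>l\<close> compares the total number of pieces with \<open>M powr p\<close>.
\<close>

lemma lp_estimate_of_piece_counts:
  fixes V :: "nat \<Rightarrow> real" and N :: "nat \<Rightarrow> nat" and p K d M :: real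
  assumes p: "1 \<le> p" and K: "1 \<le> K" and d: "0 < d" and M: "0 < M"
    and V0: "\<And>l. l < n \<Longrightarrow> 0 \<le> V l"
    and lower: "\<And>l. l < n \<Longrightarrow> d * real (N l) powr (1 / p) / (2 * K) \<le> V l + d"
    and upper: "\<And>l. l < n \<Longrightarrow> V l \<le> 2 * K * d * real (N l) powr (1 / p) + d"
    and small: "real n * d powr p \<le> M powr p / 2" and total: "(\<Sum>l<n. V l powr p) = M powr p"
  shows "M / (6 * K) \<le> d * real (\<Sum>l<n. N l) powr (1 / p)"
    and "d * real (\<Sum>l<n. N l) powr (1 / p) \<le> 8 * K * M"
proof -
  define R where "R = real (\<Sum>l<n. N l)"
  have R0: "0 \<le> R" by (simp add: R_def sum_nonneg)
  have scale: "(c * d * t powr (1 / p)) powr p = (c * d) powr p * t" if "0 \<le> c" "0 \<le> t" for c t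
    using that d p by (simp add: powr_mult powr_p_inverse)
  have up: "V l powr p \<le> (3 * K * d) powr p * real (N l) + d powr p" if l: "l < n" for l
  proof (cases "N l = 0")
    case True
    then have "V l \<le> d" using upper[OF l] p by simp
    then show ?thesis using powr_mono2[of p "V l" d] V0[OF l] p True by simp
  next
    case False
    then have "1 \<le> real (N l) powr (1 / p)" using p by (simp add: ge_one_powr_ge_zero)
    then have "d * 1 \<le> K * d * real (N l) powr (1 / p)"
      using K d mult_mono[of 1 K d "d * real (N l) powr (1 / p)"]
      by (simp add: mult_ac)
    then have "V l \<le> 3 * K * d * real (N l) powr (1 / p)" using upper[OF l] by simp
    then have "V l powr p \<le> (3 * K * d * real (N l) powr (1 / p)) powr p"
      using V0[OF l] p by (intro powr_mono2) auto
    then show ?thesis using scale[of "3 * K" "real (N l)"] K by (intro add_increasing2) simp_all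
  qed
  have lo: "d powr p * real (N l) \<le> (4 * K) powr p * (V l powr p + d powr p)" if l: "l < n" for l
  proof -
    have "d * real (N l) powr (1 / p) \<le> 2 * K * (V l + d)" using lower[OF l] K by (simp add: field_simps)
    also have "\<dots> \<le> 2 * K * (2 * max (V l) d)" using K by (intro mult_left_mono) auto
    finally have le: "d * real (N l) powr (1 / p) \<le> 4 * K * max (V l) d" by simp
    have "d powr p * real (N l) = (d * real (N l) powr (1 / p)) powr p"
      using scale[of 1 "real (N l)"] by simp
    also have "\<dots> \<le> (4 * K * max (V l) d) powr p" using le d p by (intro powr_mono2) auto
    also have "\<dots> = (4 * K) powr p * max (V l) d powr p" using K d by (simp add: powr_mult)
    also have "\<dots> \<le> (4 * K) powr p * (V l powr p + d powr p)"
      by (intro mult_left_mono) (auto simp: max_def)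
    finally show ?thesis .
  qed
  have "M powr p \<le> (\<Sum>l<n. (3 * K * d) powr p * real (N l) + d powr p)"
    unfolding total[symmetric] by (rule sum_mono) (use up in auto)
  also have "\<dots> = (3 * K * d) powr p * R + real n * d powr p"
    by (simp add: sum.distrib sum_distrib_left R_def)
  finally have half: "M powr p / 2 \<le> (3 * K * d) powr p * R" using small by simp
  have two: "2 \<le> (2::real) powr p" using powr_mono[of 1 p 2] p by simp
  have "(M / 2) powr p \<le> M powr p / 2"
  proof -
    have "(M / 2) powr p = M powr p / 2 powr p" using M by (simp add: powr_divide)
    also have "\<dots> \<le> M powr p / 2" using two by (intro divide_left_mono) auto
    finally show ?thesis .
  qed
  also note half
  also have "(3 * K * d) powr p * R = (3 * K * d * R powr (1 / p)) powr p"
    using scale[of "3 * K" R] K R0 by simp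
  finally have "M / 2 \<le> 3 * K * d * R powr (1 / p)"
    by (rule powr_le_imp_le) (use K d p in auto)
  then show "M / (6 * K) \<le> d * real (\<Sum>l<n. N l) powr (1 / p)"
    unfolding R_def[symmetric] using K by (simp add: field_simps)
  have "(d * R powr (1 / p)) powr p = (\<Sum>l<n. d powr p * real (N l))"
    using scale[of 1 R] R0 by (simp add: R_def sum_distrib_left)
  also have "\<dots> \<le> (\<Sum>l<n. (4 * K) powr p * (V l powr p + d powr p))"
    by (rule sum_mono) (use lo in auto)
  also have "\<dots> = (4 * K) powr p * (M powr p + real n * d powr p)"
    by (simp add: sum_distrib_left[symmetric] sum.distrib total)
  also have "\<dots> \<le> (4 * K) powr p * (2 powr p * M powr p)"
  proof (intro mult_left_mono)
    have "M powr p + real n * d powr p \<le> 2 * M powr p"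
      using small powr_ge_zero[of M p] by linarith
    also have "\<dots> \<le> 2 powr p * M powr p" using two by (intro mult_right_mono) auto
    finally show "M powr p + real n * d powr p \<le> 2 powr p * M powr p" .
  qed simp
  also have "\<dots> = (4 * K * (2 * M)) powr p"
    using K M powr_mult[of "4 * K" "2 * M" p] powr_mult[of 2 M p] by simp
  finally have "d * R powr (1 / p) \<le> 4 * K * (2 * M)"
    by (rule powr_le_imp_le) (use K M p in auto)
  then show "d * real (\<Sum>l<n. N l) powr (1 / p) \<le> 8 * K * M"
    unfolding R_def[symmetric] by simp
qed

text \<open>
  The vectors \<open>v l = (\<Sum>j=s l..<s (Suc l). c l j *\<^sub>R x j)\<close> satisfy the upper and lower \<open>\<ell>\<^sub>p\<close> estimates with
  constants \<open>D\<close> and \<open>A\<close>, provided that they start late and that all coefficients are small compared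
  with the \<open>\<ell>\<^sub>p\<close> norm \<open>M\<close> of the norms of the \<open>v l\<close>.
\<close>

definition spread_lp ::
  "real \<Rightarrow> real \<Rightarrow> real \<Rightarrow> (nat \<Rightarrow> 'a::real_normed_vector) \<Rightarrow> nat \<Rightarrow> nat \<Rightarrow> real \<Rightarrow> bool" where
  "spread_lp p A D x n T \<eta> \<longleftrightarrow> (\<forall>s c M. (\<forall>l<n. s l \<le> s (Suc l)) \<longrightarrow> T \<le> s 0 \<longrightarrow> 0 < M \<longrightarrow>
     (\<forall>l<n. \<forall>j. s l \<le> j \<longrightarrow> j < s (Suc l) \<longrightarrow> \<bar>c l j\<bar> \<le> \<eta> * M) \<longrightarrow>
     (\<Sum>l<n. norm (\<Sum>j=s l..<s (Suc l). c l j *\<^sub>R x j) powr p) = M powr p \<longrightarrow>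
     M / A \<le> norm (\<Sum>l<n. \<Sum>j=s l..<s (Suc l). c l j *\<^sub>R x j) \<and>
     norm (\<Sum>l<n. \<Sum>j=s l..<s (Suc l). c l j *\<^sub>R x j) \<le> D * M)"

text \<open>
  All \<open>v l\<close> are split into pieces of norm about \<open>\<delta> * M\<close>. By \<open>lp_sums\<close>, the norm of each \<open>v l\<close> and that of
  the total sum are determined, up to constants, by the number of pieces; so the norm of the sum
  is comparable to \<open>M\<close>. The length of the \<open>v l\<close> does not matter, because the number of pieces is bounded in terms
  of \<open>n\<close>: too many pieces would have a sum of too large a norm.
\<close>

lemma lp_sums_imp_spread_lp:
  fixes x :: "nat \<Rightarrow> 'a::real_normed_vector"
  assumes fl: "lp_sums p K x" and K: "1 \<le> K" and p: "1 \<le> p" and ib: "initial_bounded B x" and B: "1 \<le> B"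
    and nrm: "\<And>i. norm (x i) = 1" and n: "1 \<le> n"
  shows "\<exists>T. \<exists>\<eta>>0. spread_lp p (24 * K\<^sup>2) (17 * K\<^sup>2) x n T \<eta>"
proof -
  \<comment> \<open>The \<open>n\<close> remainders, each of norm below \<open>\<delta> * M\<close>, use up half of the lower estimate \<open>M / (12 * K\<^sup>2)\<close>.\<close>
  define \<delta> where "\<delta> = 1 / (24 * K\<^sup>2 * real n)"
  \<comment> \<open>The estimate of \<open>T'\<close> pieces from below exceeds \<open>B * M\<close>, which bounds all initial segments of a \<open>v l\<close>.\<close>
  define T' where "T' = Suc (nat \<lceil>(2 * K * B / \<delta>) powr p\<rceil>)"
  define T where "T = n * T'"
  \<comment> \<open>At most \<open>T\<close> pieces occur; an excess of \<open>\<eta> * M\<close> in each norm is then harmless.\<close>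
  define \<eta> where "\<eta> = \<delta> / (2 * K * real T)"
  have K2: "1 \<le> K\<^sup>2" using K by (simp add: one_le_power)
  have d0: "0 < \<delta>" using K n by (simp add: \<delta>_def)
  have nd: "real n * \<delta> = 1 / (24 * K\<^sup>2)" using n by (simp add: \<delta>_def)
  have nd1: "real n * \<delta> \<le> 1 / 24"
    unfolding nd using K2 by (intro divide_left_mono) auto
  have d1: "\<delta> \<le> 1"
  proof -
    have "1 * \<delta> \<le> real n * \<delta>" using n d0 by (intro mult_right_mono) auto
    then show ?thesis using nd1 by simp
  qed
  have T0: "0 < T" using n by (simp add: T_def T'_def)
  have T'_gt: "(2 * K * B / \<delta>) powr p < real T'" unfolding T'_def by linarith
  have \<eta>0: "0 < \<eta>" using d0 K T0 by (simp add: \<eta>_def)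
  have "spread_lp p (24 * K\<^sup>2) (17 * K\<^sup>2) x n T \<eta>"
    unfolding spread_lp_def
  proof (intro allI impI)
    fix s :: "nat \<Rightarrow> nat" and c :: "nat \<Rightarrow> nat \<Rightarrow> real" and M :: real
    assume s': "\<forall>l<n. s l \<le> s (Suc l)" and sT: "T \<le> s 0" and M: "0 < M"
      and c': "\<forall>l<n. \<forall>j. s l \<le> j \<longrightarrow> j < s (Suc l) \<longrightarrow> \<bar>c l j\<bar> \<le> \<eta> * M"
      and tot: "(\<Sum>l<n. norm (\<Sum>j=s l..<s (Suc l). c l j *\<^sub>R x j) powr p) = M powr p"
    note s = s'[rule_format] and c = c'[rule_format]
    define v where "v l = (\<Sum>j=s l..<s (Suc l). c l j *\<^sub>R x j)" for l
    define d where "d = \<delta> * M"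
    have d: "0 < d" using d0 M by (simp add: d_def)
    have small_len: "real k * (\<eta> * M) \<le> d / (2 * K)" if "k \<le> T" for k
    proof -
      have "real k * (\<eta> * M) \<le> real T * (\<eta> * M)" using that \<eta>0 M by (intro mult_right_mono) auto
      also have "\<dots> = d / (2 * K)" using T0 by (simp add: \<eta>_def d_def)
      finally show ?thesis .
    qed
    define split where "split l gs \<longleftrightarrow> successive x (s l) gs (s (Suc l)) \<and>
        (\<forall>g\<in>set gs. d \<le> norm g \<and> norm g \<le> d + \<eta> * M) \<and> norm (v l - sum_list gs) < d \<and>
        (\<forall>i. \<exists>u. s l \<le> u \<and> u \<le> s (Suc l) \<and> sum_list (take i gs) = (\<Sum>j=s l..<u. c l j *\<^sub>R x j))"
      for l gs
    have "\<exists>gs. split l gs" if l: "l < n" for l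
      unfolding split_def v_def
      by (rule greedy_splitting[OF s[OF l] d, of "c l" x "\<eta> * M"])
        (use c[OF l] nrm in simp, blast)
    then obtain gs where gs_split: "\<And>l. l < n \<Longrightarrow> split l (gs l)" by metis
    note gs = gs_split[unfolded split_def, THEN conjunct1]
      gs_split[unfolded split_def, THEN conjunct2, THEN conjunct1, rule_format]
      gs_split[unfolded split_def, THEN conjunct2, THEN conjunct2, THEN conjunct1]
      gs_split[unfolded split_def, THEN conjunct2, THEN conjunct2, THEN conjunct2, rule_format]
    have s0: "l \<le> n \<Longrightarrow> s 0 \<le> s l" for l
    proof (induction l)
      case (Suc l)
      then show ?case using s[of l] by simp
    qed simp
    have vM: "norm (v l) \<le> M" if "l < n" for l
    proof (rule powr_le_imp_le)
      have "norm (v l) powr p \<le> (\<Sum>l<n. norm (v l) powr p)"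
        using that by (intro member_le_sum) auto
      then show "norm (v l) powr p \<le> M powr p" using tot by (simp add: v_def)
    qed (use M p in auto)
    \<comment> \<open>More than \<open>T'\<close> pieces would give an initial segment of \<open>v l\<close> too large a norm.\<close>
    have len: "length (gs l) \<le> T'" if l: "l < n" for l
    proof (rule ccontr)
      assume "\<not> length (gs l) \<le> T'"
      then have lt: "length (take T' (gs l)) = T'" by simp
      have T'T: "T' \<le> T" using n by (simp add: T_def)
      obtain u where u: "s l \<le> u" "u \<le> s (Suc l)" "sum_list (take T' (gs l)) = (\<Sum>j=s l..<u. c l j *\<^sub>R x j)"
        using gs(4)[OF l] by blast
      have "d * real (length (take T' (gs l))) powr (1 / p) / (2 * K) \<le> norm (sum_list (take T' (gs l)))"
      proof (rule lp_sums_almost_equal_norms(1)[OF fl K p successive_take[OF gs(1)[OF l]] _ d])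
        show "length (take T' (gs l)) \<le> s l" using lt T'T sT s0[of l] l by simp
        show "d \<le> norm g \<and> norm g \<le> d + \<eta> * M" if "g \<in> set (take T' (gs l))" for g
          using gs(2)[OF l] in_set_takeD[OF that] by blast
        show "real (length (take T' (gs l))) * (\<eta> * M) \<le> d / (2 * K)"
          using small_len lt T'T by simp
      qed
      also have "norm (sum_list (take T' (gs l))) \<le> B * norm (v l)"
        unfolding u(3) v_def by (rule initial_bounded_segment[OF ib u(1,2)])
      also have "\<dots> \<le> B * M" using vM[OF l] B by (intro mult_left_mono) auto
      finally have "\<delta> * real T' powr (1 / p) * M \<le> 2 * K * B * M"
        using K lt by (simp add: d_def field_simps)
      then have "real T' powr (1 / p) \<le> 2 * K * B / \<delta>" using M d0 by (simp add: field_simps)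
      then have "(real T' powr (1 / p)) powr p \<le> (2 * K * B / \<delta>) powr p"
        using p by (intro powr_mono2) auto
      then show False using T'_gt p by (simp add: powr_p_inverse)
    qed
    define N where "N l = length (gs l)" for l
    define cs where "cs = concat (map gs [0..<n])"
    have cs_len: "length cs = (\<Sum>l<n. N l)" by (simp add: cs_def length_concat_upt N_def)
    have "(\<Sum>l<n. N l) \<le> (\<Sum>l<n. T')" by (rule sum_mono) (use len in \<open>auto simp: N_def\<close>)
    then have cs_T: "length cs \<le> T" by (simp add: cs_len T_def)
    have cs_succ: "successive x (s 0) cs (s n)"
      unfolding cs_def by (rule successive_concat) (rule gs(1))
    have cs_nrm: "d \<le> norm g \<and> norm g \<le> d + \<eta> * M" if "g \<in> set cs" for g
      using that gs(2) by (auto simp: cs_def)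
    have cs_s: "length cs \<le> s 0" using cs_T sT by simp
    note cs_est = lp_sums_almost_equal_norms[OF fl K p cs_succ cs_s d cs_nrm small_len[OF cs_T]]
    have piece: "d * real (N l) powr (1 / p) / (2 * K) \<le> norm (sum_list (gs l))"
      "norm (sum_list (gs l)) \<le> 2 * K * d * real (N l) powr (1 / p)" if l: "l < n" for l
    proof -
      have lT: "length (gs l) \<le> T"
      proof -
        have "T' \<le> T" using n by (simp add: T_def)
        then show ?thesis using len[OF l] by simp
      qed
      have ls: "length (gs l) \<le> s l" using lT sT s0[of l] l by simp
      show "d * real (N l) powr (1 / p) / (2 * K) \<le> norm (sum_list (gs l))"
        "norm (sum_list (gs l)) \<le> 2 * K * d * real (N l) powr (1 / p)"
        unfolding N_def
        using lp_sums_almost_equal_norms[OF fl K p gs(1)[OF l] ls d gs(2)[OF l] small_len[OF lT]] by blast+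
    qed
    have close: "norm (v l - sum_list (gs l)) \<le> d" if "l < n" for l using gs(3)[OF that] by simp
    have dp: "real n * d powr p \<le> M powr p / 2"
    proof -
      have "\<delta> powr p \<le> \<delta> powr 1" using d0 d1 p by (intro powr_mono') auto
      then have "real n * \<delta> powr p \<le> real n * \<delta>" using d0 by (intro mult_left_mono) auto
      then have "real n * \<delta> powr p \<le> 1 / 2" using nd1 by simp
      then have "real n * \<delta> powr p * M powr p \<le> 1 / 2 * M powr p" by (intro mult_right_mono) auto
      then show ?thesis using d0 M by (simp add: d_def powr_mult)
    qed
    define \<rho> where "\<rho> = d * real (\<Sum>l<n. N l) powr (1 / p)"
    have rho: "M / (6 * K) \<le> \<rho>" "\<rho> \<le> 8 * K * M"
      unfolding \<rho>_def
    proof (rule_tac [!] lp_estimate_of_piece_counts[OF p K d M, where V="\<lambda>l. norm (v l)"])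
      show "(\<Sum>l<n. norm (v l) powr p) = M powr p" "(\<Sum>l<n. norm (v l) powr p) = M powr p"
        using tot by (simp_all add: v_def)
      show "d * real (N l) powr (1 / p) / (2 * K) \<le> norm (v l) + d"
        "d * real (N l) powr (1 / p) / (2 * K) \<le> norm (v l) + d"
        "norm (v l) \<le> 2 * K * d * real (N l) powr (1 / p) + d"
        "norm (v l) \<le> 2 * K * d * real (N l) powr (1 / p) + d" if "l < n" for l
        using piece[OF that] close[OF that] norm_triangle_ineq2[of "v l" "sum_list (gs l)"]
          norm_triangle_ineq2[of "sum_list (gs l)" "v l"] by (simp_all add: norm_minus_commute)
    qed (use dp in auto)
    have "norm ((\<Sum>l<n. v l) - sum_list cs) = norm (\<Sum>l<n. v l - sum_list (gs l))"
      by (simp add: cs_def sum_list_concat_upt sum_subtractf)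
    also have "\<dots> \<le> (\<Sum>l<n. d)" by (rule order_trans[OF norm_sum], rule sum_mono) (use close in auto)
    also have "\<dots> = M / (24 * K\<^sup>2)" by (simp add: d_def nd flip: mult.assoc)
    finally have err: "norm ((\<Sum>l<n. v l) - sum_list cs) \<le> M / (24 * K\<^sup>2)" .
    have lo: "\<rho> / (2 * K) \<le> norm (sum_list cs)" and hi: "norm (sum_list cs) \<le> 2 * K * \<rho>"
      using cs_est by (simp_all add: \<rho>_def cs_len)
    have "M / (12 * K\<^sup>2) = M / (6 * K) / (2 * K)" by (simp add: power2_eq_square)
    also have "\<dots> \<le> \<rho> / (2 * K)" using rho(1) K by (intro divide_right_mono) auto
    finally have "2 * (M / (24 * K\<^sup>2)) \<le> norm (sum_list cs)" using lo by simp
    then have A: "M / (24 * K\<^sup>2) \<le> norm (\<Sum>l<n. v l)"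
      using err norm_triangle_ineq2[of "sum_list cs" "\<Sum>l<n. v l"] by (simp add: norm_minus_commute)
    have "2 * K * \<rho> \<le> 2 * K * (8 * K * M)" using rho(2) K by (intro mult_left_mono) auto
    then have h1: "norm (sum_list cs) \<le> 16 * K\<^sup>2 * M" using hi by (simp add: power2_eq_square mult_ac)
    have "M / (24 * K\<^sup>2) \<le> M / 1" using K2 M by (intro divide_left_mono) auto
    also have "\<dots> \<le> K\<^sup>2 * M" using K2 M by simp
    finally have "norm (\<Sum>l<n. v l) \<le> 17 * K\<^sup>2 * M"
      using err h1 norm_triangle_ineq2[of "\<Sum>l<n. v l" "sum_list cs"] by simp
    with A show "M / (24 * K\<^sup>2) \<le> norm (\<Sum>l<n. \<Sum>j=s l..<s (Suc l). c l j *\<^sub>R x j) \<and>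
      norm (\<Sum>l<n. \<Sum>j=s l..<s (Suc l). c l j *\<^sub>R x j) \<le> 17 * K\<^sup>2 * M"
      by (simp add: v_def)
  qed
  with \<eta>0 show ?thesis by blast
qed

section \<open>Fast averages\<close>

text \<open>
  For \<open>i \<ge> b 0\<close> and strictly increasing \<open>b\<close>, the \<open>j\<close> with \<open>b j \<le> i < b (Suc j)\<close>.
\<close>

definition block_index :: "(nat \<Rightarrow> nat) \<Rightarrow> nat \<Rightarrow> nat" where
  "block_index b i = (LEAST j. i < b (Suc j))"

lemma block_index_eq:
  assumes b: "strict_mono b" and ij: "b j \<le> i" "i < b (Suc j)"
  shows "block_index b i = j"
  unfolding block_index_def
proof (rule Least_equality)
  fix k assume "i < b (Suc k)"
  then have "b j < b (Suc k)" using ij by simp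
  then show "j \<le> k" using strict_mono_less[OF b] by auto
qed (rule ij)

lemma block_index_bounds:
  assumes b: "strict_mono b" and b0: "b 0 \<le> i"
  shows "b (block_index b i) \<le> i" "i < b (Suc (block_index b i))"
proof -
  have "Suc i \<le> b (Suc i)" by (rule strict_mono_imp_increasing[OF b])
  then have ex: "i < b (Suc i)" by simp
  show "i < b (Suc (block_index b i))"
    unfolding block_index_def using LeastI[of "\<lambda>j. i < b (Suc j)", OF ex] .
  show "b (block_index b i) \<le> i"
  proof (cases "block_index b i")
    case 0
    then show ?thesis using b0 by simp
  next
    case (Suc m)
    then have "\<not> i < b (Suc m)"
      using not_less_Least[of m "\<lambda>j. i < b (Suc j)"] by (simp add: block_index_def)
    then show ?thesis using Suc by simp
  qed
qed

lemma weighted_blocks_sum: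
  fixes x :: "nat \<Rightarrow> 'a::real_vector" and b :: "nat \<Rightarrow> nat"
  assumes b: "strict_mono b"
    and e: "\<And>j. e j = (\<Sum>i=b j..<b (Suc j). w i *\<^sub>R x i)" and kl: "k \<le> l"
  shows "(\<Sum>j=k..<l. \<beta> j *\<^sub>R e j) = (\<Sum>i=b k..<b l. (\<beta> (block_index b i) * w i) *\<^sub>R x i)"
  using kl
proof (induction l rule: dec_induct)
  case (step l)
  have "\<beta> l *\<^sub>R e l = (\<Sum>i=b l..<b (Suc l). (\<beta> (block_index b i) * w i) *\<^sub>R x i)"
    unfolding e scaleR_sum_right by (rule sum.cong) (auto simp: block_index_eq[OF b])
  moreover have "b k \<le> b l" "b l \<le> b (Suc l)" using b step.hyps by (auto simp: strict_mono_less_eq)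
  ultimately show ?case using step
    by (simp add: sum.atLeastLessThan_concat[of "b k" "b l" "b (Suc l)", symmetric])
qed simp

lemma initial_bounded_blocks:
  assumes ib: "initial_bounded B x" and b: "strict_mono b"
    and e: "\<And>j. e j = (\<Sum>i=b j..<b (Suc j). w i *\<^sub>R x i)"
  shows "initial_bounded B e"
  unfolding initial_bounded_def
proof (intro allI impI)
  fix a :: "nat \<Rightarrow> real" and q r :: nat assume qr: "q \<le> r"
  have "b 0 \<le> b q" "b q \<le> b r" using b qr by (auto simp: strict_mono_less_eq)
  from initial_bounded_segment[OF ib this, of "\<lambda>i. a (block_index b i) * w i"]
  show "coeff_norm q e a \<le> B * coeff_norm r e a"
    using weighted_blocks_sum[OF b e, of 0 q a] weighted_blocks_sum[OF b e, of 0 r a]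
    by (simp add: coeff_norm_def atLeast0LessThan)
qed

text \<open>
  A long sum of the \<open>x i\<close> has large norm, so its normalization has small coefficients. The sum of
  \<open>G j\<close> terms is estimated by \<open>lp_sums\<close> only if it starts after index \<open>G j\<close>, and this is why gaps are left
  between consecutive sums; the weights vanish there.
\<close>

lemma lp_sums_fast_averages:
  fixes x :: "nat \<Rightarrow> 'a::real_normed_vector" and T :: "nat \<Rightarrow> nat"
  assumes fl: "lp_sums p K x" and K: "0 < K" and p: "1 \<le> p" and nrm: "\<And>i. norm (x i) = 1"
    and \<omega>: "\<And>j. 0 < \<omega> j"
  obtains b :: "nat \<Rightarrow> nat" and w :: "nat \<Rightarrow> real" where "strict_mono b" "\<And>j. T j \<le> b j"
    "\<And>j. norm (\<Sum>i=b j..<b (Suc j). w i *\<^sub>R x i) = 1"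
    "\<And>j i. b j \<le> i \<Longrightarrow> i < b (Suc j) \<Longrightarrow> \<bar>w i\<bar> \<le> \<omega> j"
proof -
  define G where "G j = Suc (T j + nat \<lceil>(K / \<omega> j) powr p\<rceil>)" for j
  define b where "b = rec_nat (G 0) (\<lambda>j r. r + G j + G (Suc j))"
  have b0: "b 0 = G 0" and bS: "b (Suc j) = b j + G j + G (Suc j)" for j by (simp_all add: b_def)
  have bG: "G j \<le> b j" for j by (cases j) (simp_all add: b0 bS)
  have Gpos: "0 < G j" for j by (simp add: G_def)
  have mono: "strict_mono b" unfolding strict_mono_Suc_iff bS using Gpos by simp
  define J where "J = block_index b"
  have J: "b j \<le> i \<Longrightarrow> i < b (Suc j) \<Longrightarrow> J i = j" for i j
    unfolding J_def by (rule block_index_eq[OF mono])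
  define s where "s j = (\<Sum>i=b j..<b j + G j. x i)" for j
  have s_ge: "1 / \<omega> j \<le> norm (s j)" for j
  proof -
    have "normalized_block_basis x (G j) (G j) (\<lambda>l. x (b j + l))"
      unfolding normalized_block_basis_def
      by (intro exI[of _ "\<lambda>l. b j + l"]) (auto simp: bG nrm span_base)
    moreover have "1 \<le> G j" by (simp add: G_def)
    ultimately have "inverse K * real (G j) powr (1 / p) \<le> norm (\<Sum>l<G j. x (b j + l))"
      using fl unfolding lp_sums_def by blast
    also have "(\<Sum>l<G j. x (b j + l)) = s j"
      unfolding s_def using sum.shift_bounds_nat_ivl[of x 0 "b j" "G j"]
      by (simp add: atLeast0LessThan add.commute)
    finally have 1: "inverse K * real (G j) powr (1 / p) \<le> norm (s j)" .
    have pos: "0 < K / \<omega> j" using K \<omega> by simp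
    have "(K / \<omega> j) powr p \<le> real (G j)" unfolding G_def by linarith
    then have "((K / \<omega> j) powr p) powr (1 / p) \<le> real (G j) powr (1 / p)"
      using p by (intro powr_mono2) auto
    moreover have "((K / \<omega> j) powr p) powr (1 / p) = K / \<omega> j"
      using pos p by (simp add: powr_powr del: abs_divide)
    ultimately have "inverse K * (K / \<omega> j) \<le> inverse K * real (G j) powr (1 / p)"
      using K by (intro mult_left_mono) auto
    then have "1 / \<omega> j \<le> inverse K * real (G j) powr (1 / p)" using K by simp
    then show ?thesis using 1 by linarith
  qed
  have s_pos: "0 < norm (s j)" for j
  proof -
    have "0 < 1 / \<omega> j" using \<omega> by simp
    then show ?thesis using s_ge[of j] by linarith
  qed
  define w where "w i = (if i < b (J i) + G (J i) then 1 / norm (s (J i)) else 0)" for i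
  show ?thesis
  proof (rule that[OF mono, of w])
    show "T j \<le> b j" for j using bG[of j] by (simp add: G_def)
    show "\<bar>w i\<bar> \<le> \<omega> j" if "b j \<le> i" "i < b (Suc j)" for i j
    proof -
      have "1 / norm (s j) \<le> \<omega> j" using s_ge[of j] s_pos[of j] \<omega>[of j] by (simp add: field_simps)
      then show ?thesis using J[OF that] \<omega>[of j] by (auto simp: w_def)
    qed
    fix j
    have "(\<Sum>i=b j..<b (Suc j). w i *\<^sub>R x i) = (\<Sum>i=b j..<b j + G j. w i *\<^sub>R x i)"
    proof (rule sum.mono_neutral_right)
      show "\<forall>i\<in>{b j..<b (Suc j)} - {b j..<b j + G j}. w i *\<^sub>R x i = 0"
      proof
        fix i assume i: "i \<in> {b j..<b (Suc j)} - {b j..<b j + G j}"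
        then have "J i = j" using J[of j i] by simp
        then show "w i *\<^sub>R x i = 0" using i by (simp add: w_def)
      qed
    qed (auto simp: bS)
    also have "\<dots> = (\<Sum>i=b j..<b j + G j. (1 / norm (s j)) *\<^sub>R x i)"
    proof (rule sum.cong)
      fix i assume "i \<in> {b j..<b j + G j}"
      then have "J i = j" "i < b j + G j" using J[of j i] by (auto simp: bS)
      then show "w i *\<^sub>R x i = (1 / norm (s j)) *\<^sub>R x i" by (simp add: w_def)
    qed simp
    also have "\<dots> = (1 / norm (s j)) *\<^sub>R s j" by (simp add: s_def scaleR_sum_right)
    finally show "norm (\<Sum>i=b j..<b (Suc j). w i *\<^sub>R x i) = 1" using s_pos[of j] by simp
  qed
qed

lemma lp_coeff_norm_powr:
  assumes "1 \<le> p"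
  shows "lp_coeff_norm p n a powr p = (\<Sum>i<n. \<bar>a i\<bar> powr p)"
  using assms by (simp add: lp_coeff_norm_def powr_p_inverse sum_nonneg)

lemma lp_coeff_norm_ge:
  assumes "1 \<le> p" "l < n"
  shows "\<bar>a l\<bar> \<le> lp_coeff_norm p n a"
proof (rule powr_le_imp_le)
  show "\<bar>a l\<bar> powr p \<le> lp_coeff_norm p n a powr p"
    unfolding lp_coeff_norm_powr[OF assms(1)] using assms(2) by (intro member_le_sum) auto
qed (use assms in \<open>auto simp: lp_coeff_norm_def\<close>)

lemma C_equivalent_lp_if:
  assumes AB: "0 < A" "0 < B" and p: "1 \<le> p"
    and est: "\<And>a. 0 < lp_coeff_norm p n a \<Longrightarrow> lp_coeff_norm p n a / A \<le> coeff_norm n x a \<and>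
       coeff_norm n x a \<le> B * lp_coeff_norm p n a"
  shows "C_equivalent (A * B) (coeff_norm n x) (lp_coeff_norm p n)"
  unfolding C_equivalent_def
proof (rule exI[of _ A], rule exI[of _ B], intro conjI allI AB)
  fix a
  have "inverse A * lp_coeff_norm p n a \<le> coeff_norm n x a \<and> coeff_norm n x a \<le> B * lp_coeff_norm p n a"
  proof (cases "lp_coeff_norm p n a = 0")
    case True
    then have "a l = 0" if "l < n" for l using lp_coeff_norm_ge[OF p that, of a] by simp
    then have "coeff_norm n x a = 0" by (simp add: coeff_norm_def)
    then show ?thesis using True by simp
  next
    case False
    then have "0 < lp_coeff_norm p n a" by (simp add: lp_coeff_norm_def)
    then show ?thesis using est[of a] by (simp add: field_simps)
  qed
  then show "inverse A * lp_coeff_norm p n a \<le> coeff_norm n x a"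
    "coeff_norm n x a \<le> B * lp_coeff_norm p n a" by auto
qed simp

text \<open>
  A block of fast averages is a combination of the \<open>x i\<close> with small coefficients, whatever its length,
  so \<open>spread_lp\<close> applies to the normalized blocks after scaling them by the given scalars.
\<close>

theorem asymptotic_lp_of_lp_sums:
  fixes x :: "nat \<Rightarrow> 'a::banach"
  assumes fl: "lp_sums p K x" and K: "1 \<le> K" and p: "1 \<le> p" and ib: "initial_bounded B x" and B: "1 \<le> B"
    and nrm: "\<And>i. norm (x i) = 1"
  obtains e where "range e \<subseteq> span (range x)" "asymptotic_lp p e"
proof -
  let ?good = "spread_lp p (24 * K\<^sup>2) (17 * K\<^sup>2) x"
  obtain T \<eta> where T\<eta>: "\<And>n. 1 \<le> n \<Longrightarrow> 0 < \<eta> n" "\<And>n. 1 \<le> n \<Longrightarrow> ?good n (T n) (\<eta> n)"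
    using lp_sums_imp_spread_lp[OF fl K p ib B nrm] by metis
  \<comment> \<open>From \<open>e j\<close> on, the requirements for all lengths \<open>n \<le> j + 1\<close> are met.\<close>
  define T' where "T' j = (\<Sum>n\<le>Suc j. T n)" for j
  \<comment> \<open>Coefficients of a normalized block with respect to \<open>e\<close> are bounded by \<open>2 * B\<close>.\<close>
  define \<omega> where "\<omega> j = Min (\<eta> ` {1..Suc j}) / (2 * B)" for j
  have om_pos: "0 < \<omega> j" for j using T\<eta>(1) B by (auto simp: \<omega>_def)
  obtain b w where mono: "strict_mono b" and bT: "\<And>j. T' j \<le> b j"
    and e_nrm: "\<And>j. norm (\<Sum>i=b j..<b (Suc j). w i *\<^sub>R x i) = 1"
    and w: "\<And>j i. b j \<le> i \<Longrightarrow> i < b (Suc j) \<Longrightarrow> \<bar>w i\<bar> \<le> \<omega> j"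
  proof (rule lp_sums_fast_averages[OF fl _ p nrm om_pos, of T'])
    show "0 < K" using K by simp
  qed (rule that)
  define e where "e j = (\<Sum>i=b j..<b (Suc j). w i *\<^sub>R x i)" for j
  define J where "J = block_index b"
  have J_at: "b 0 \<le> i \<Longrightarrow> b (J i) \<le> i \<and> i < b (Suc (J i))" for i
    unfolding J_def using block_index_bounds[OF mono] by blast
  have ibe: "initial_bounded B e" by (rule initial_bounded_blocks[OF ib mono e_def])
  have e1: "norm (e j) = 1" for j using e_nrm by (simp add: e_def)
  have J_ge: "k \<le> J i" if "b k \<le> i" for i k
  proof -
    have "b 0 \<le> b k" using mono by (simp add: strict_mono_less_eq)
    then have "i < b (Suc (J i))" using J_at[of i] that by simp
    then have "b k < b (Suc (J i))" using that by simp
    then show ?thesis using strict_mono_less[OF mono] by simp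
  qed
  show ?thesis
  proof (rule that)
    show "range e \<subseteq> span (range x)"
      unfolding e_def by (intro image_subsetI span_sum span_scale span_base rangeI)
    show "asymptotic_lp p e"
      unfolding asymptotic_lp_def
    proof (intro conjI exI allI impI)
      show "basic_sequence e" by (rule initial_bounded_imp_basic[OF e1 ibe])
      fix n y assume n: "1 \<le> n" and "normalized_block_basis e (n - 1) n y"
      then obtain k where k0: "n - 1 \<le> k 0" and k: "\<And>l. l < n \<Longrightarrow> k l < k (Suc l)"
        "\<And>l. l < n \<Longrightarrow> y l \<in> span (e ` {k l..<k (Suc l)})" "\<And>l. l < n \<Longrightarrow> norm (y l) = 1"
        unfolding normalized_block_basis_def by blast
      have k_ge: "l \<le> n \<Longrightarrow> k 0 \<le> k l" for l
      proof (induction l)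
        case (Suc l)
        then show ?case using k(1)[of l] by simp
      qed simp
      have "\<exists>\<beta>. y l = (\<Sum>j=k l..<k (Suc l). \<beta> j *\<^sub>R e j) \<and> (\<forall>j<k (Suc l). \<bar>\<beta> j\<bar> \<le> 2 * B)"
        if l: "l < n" for l
      proof -
        obtain \<beta> :: "nat \<Rightarrow> real" and F where \<beta>: "F \<subseteq> {k l..<k (Suc l)}" "\<And>i. i \<notin> F \<Longrightarrow> \<beta> i = 0"
          "\<And>m. F \<subseteq> {..<m} \<Longrightarrow> y l = (\<Sum>i<m. \<beta> i *\<^sub>R e i)"
          by (rule span_image_coefficients[OF k(2)[OF l]]) blast
        have "F \<subseteq> {..<k (Suc l)}" using \<beta>(1) by auto
        then have y: "y l = (\<Sum>i<k (Suc l). \<beta> i *\<^sub>R e i)" by (rule \<beta>(3))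
        also have "\<dots> = (\<Sum>j=k l..<k (Suc l). \<beta> j *\<^sub>R e j)"
          by (rule sum.mono_neutral_right) (use \<beta>(1,2) in auto)
        finally have "y l = (\<Sum>j=k l..<k (Suc l). \<beta> j *\<^sub>R e j)" .
        moreover have "\<bar>\<beta> j\<bar> \<le> 2 * B" if "j < k (Suc l)" for j
          using initial_bounded_term[OF ibe that, of \<beta>] e1 y k(3)[OF l] by (simp add: coeff_norm_def)
        ultimately show ?thesis by blast
      qed
      then obtain \<beta> where \<beta>: "\<And>l. l < n \<Longrightarrow> y l = (\<Sum>j=k l..<k (Suc l). \<beta> l j *\<^sub>R e j)"
        "\<And>l j. l < n \<Longrightarrow> j < k (Suc l) \<Longrightarrow> \<bar>\<beta> l j\<bar> \<le> 2 * B" by metis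
      show "C_equivalent (24 * K\<^sup>2 * (17 * K\<^sup>2)) (coeff_norm n y) (lp_coeff_norm p n)"
      proof (rule C_equivalent_lp_if[OF _ _ p])
        show "0 < 24 * K\<^sup>2" "0 < 17 * K\<^sup>2" using K by auto
        fix a assume M: "0 < lp_coeff_norm p n a"
        define M where "M = lp_coeff_norm p n a"
        define s where "s l = b (k l)" for l
        define c where "c l i = a l * (\<beta> l (J i) * w i)" for l i
        have ay: "a l *\<^sub>R y l = (\<Sum>i=s l..<s (Suc l). c l i *\<^sub>R x i)" if l: "l < n" for l
          using weighted_blocks_sum[OF mono e_def, of "k l" "k (Suc l)" "\<beta> l"] k(1)[OF l]
          by (simp add: \<beta>(1)[OF l] s_def c_def J_def scaleR_sum_right)
        have g: "?good n (T n) (\<eta> n)" by (rule T\<eta>(2)[OF n])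
        have 1: "\<forall>l<n. s l \<le> s (Suc l)"
          using k(1) mono by (auto simp: s_def strict_mono_less_eq less_imp_le)
        have 2: "T n \<le> s 0"
        proof -
          have "T n \<le> T' (k 0)" unfolding T'_def using k0 by (intro member_le_sum) auto
          then show ?thesis using bT[of "k 0"] by (simp add: s_def)
        qed
        have 3: "\<forall>l<n. \<forall>i. s l \<le> i \<longrightarrow> i < s (Suc l) \<longrightarrow> \<bar>c l i\<bar> \<le> \<eta> n * M"
        proof (intro allI impI)
          fix l i assume l: "l < n" and i: "s l \<le> i" "i < s (Suc l)"
          have kJ: "k l \<le> J i" using J_ge i(1) by (simp add: s_def)
          have b0: "b 0 \<le> i"
            using i(1) mono by (auto simp: s_def strict_mono_less_eq intro: order_trans[of _ "b (k l)"])
          have "b (J i) < b (k (Suc l))" using J_at[OF b0] i(2) by (simp add: s_def)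
          then have Jk: "J i < k (Suc l)" using strict_mono_less[OF mono] by simp
          have "\<omega> (J i) \<le> \<eta> n / (2 * B)"
            unfolding \<omega>_def using B k0 n kJ k_ge[of l] l by (intro divide_right_mono Min_le) auto
          moreover have "\<bar>w i\<bar> \<le> \<omega> (J i)" using w J_at[OF b0] by blast
          ultimately have wi: "\<bar>w i\<bar> \<le> \<eta> n / (2 * B)" by simp
          have "\<bar>c l i\<bar> = \<bar>a l\<bar> * (\<bar>\<beta> l (J i)\<bar> * \<bar>w i\<bar>)" by (simp add: c_def abs_mult)
          also have "\<dots> \<le> M * (2 * B * (\<eta> n / (2 * B)))"
            using lp_coeff_norm_ge[OF p l, of a] \<beta>(2)[OF l Jk] wi M B
            by (intro mult_mono) (auto simp: M_def)
          also have "\<dots> = \<eta> n * M" using B by simp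
          finally show "\<bar>c l i\<bar> \<le> \<eta> n * M" .
        qed
        have 4: "(\<Sum>l<n. norm (\<Sum>j=s l..<s (Suc l). c l j *\<^sub>R x j) powr p) = M powr p"
          unfolding M_def lp_coeff_norm_powr[OF p]
          by (rule sum.cong) (auto simp: ay[symmetric] k(3))
        have "(\<Sum>l<n. \<Sum>j=s l..<s (Suc l). c l j *\<^sub>R x j) = (\<Sum>l<n. a l *\<^sub>R y l)"
          by (rule sum.cong) (auto simp: ay)
        moreover have "M / (24 * K\<^sup>2) \<le> norm (\<Sum>l<n. \<Sum>j=s l..<s (Suc l). c l j *\<^sub>R x j) \<and>
            norm (\<Sum>l<n. \<Sum>j=s l..<s (Suc l). c l j *\<^sub>R x j) \<le> 17 * K\<^sup>2 * M"
          using g[unfolded spread_lp_def, rule_format, of s M c] 1 2 3 4 M by (simp add: M_def)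
        ultimately show "lp_coeff_norm p n a / (24 * K\<^sup>2) \<le> coeff_norm n y a \<and>
            coeff_norm n y a \<le> 17 * K\<^sup>2 * lp_coeff_norm p n a"
          by (simp add: coeff_norm_def M_def)
      qed
    qed
  qed
qed

theorem theorem3p7:
  fixes z :: "nat \<Rightarrow> 'a::banach" and p K :: real
  assumes "schauder_basis_of z UNIV"
    and "1 \<le> p"
    and "\<And>n N. 1 \<le> n \<Longrightarrow> N \<in> asymptotic_structure z n \<Longrightarrow>
           inverse K * real n powr (1 / p) \<le> N (\<lambda>i. 1) \<and> N (\<lambda>i. 1) \<le> K * real n powr (1 / p)"
  shows "\<forall>X::'a set. subspace X \<and> closed X \<and> infinite_dimensional X \<longrightarrow>
           (\<exists>e::nat \<Rightarrow> 'a. range e \<subseteq> X \<and> asymptotic_lp p e)"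
proof (intro allI impI)
  fix X :: "'a set"
  assume X: "subspace X \<and> closed X \<and> infinite_dimensional X"
  interpret schauder z by (rule schauder.intro) (rule assms(1))
  obtain x :: "nat \<Rightarrow> 'a" where x: "range x \<subseteq> X" "\<And>i. norm (x i) = 1" "initial_bounded (2 * basis_const) x"
    "lp_sums p (2 * K) x"
  proof (rule lp_sums_sequence_in_subspace[of K p X])
    show "inverse K * real n powr (1 / p) \<le> N (\<lambda>i. 1) \<and> N (\<lambda>i. 1) \<le> K * real n powr (1 / p)"
      if "1 \<le> n" "N \<in> asymptotic_structure z n" for n N using assms(3) that by blast
    show "subspace X" "infinite_dimensional X" using X by auto
  qed (rule that)
  have "1 \<le> 2 * K"
  proof -
    have "normalized_block_basis x 1 1 (\<lambda>_. x 1)"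
      unfolding normalized_block_basis_def
      by (intro exI[of _ "\<lambda>i. i + 1"]) (auto simp: x(2) span_base)
    then show ?thesis using x(4) x(2) unfolding lp_sums_def by fastforce
  qed
  then obtain e where "range e \<subseteq> span (range x)" "asymptotic_lp p e"
  proof (rule asymptotic_lp_of_lp_sums[OF x(4) _ assms(2) x(3) _ x(2)])
    show "1 \<le> 2 * basis_const" using basis_const_ge_1 by simp
  qed (rule that)
  moreover have "span (range x) \<subseteq> X" using x(1) X by (simp add: span_minimal)
  ultimately show "\<exists>e. range e \<subseteq> X \<and> asymptotic_lp p e" by blast
qed

end
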